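(* Let $\mathcal M=(M,<,+,0,\ldots)$ be an archimedean DCULOAS structure. If $\mathcal M$ enjoys the definable Tietze extension property, then $\mathcal M$ is o-minimal and there exists a strictly monotone definable homeomorphism between a bounded open interval and an unbounded open interval.
   Context: "Definable" means definable in $\mathcal M$ with parameters. A DCULOAS structure is a definably complete uniformly locally o-minimal expansion of the second kind of a densely linearly ordered abelian group $(M,<,+,0)$: definably complete means every definable subset of $M$ has a supremum and infimum in $M\cup\{\pm\infty\}$; uniformly locally o-minimal of the second kind means that for every definable $X\subseteq M^{n+1}$, $a\in M$, $b\in M^n$ there are an open interval $I\ni a$ and an open box $B\ni b$ such that for all $y\in B$ the set $\{x: (y,x)\in X\}\cap I$ is a finite union of points and open intervals. $\mathcal M$ is archimedean if for all positive $a,b\in M$ there is a positive integer $n$ with $na>b$. $\mathcal M$ enjoys the definable Tietze extension property if for every $n\ge1$, every definable closed $A\subseteq M^n$ and every continuous definable $f:A\to M$ there is a definable continuous $F:M^n\to M$ extending $f$. Open intervals may have endpoints in $M\cup\{\pm\infty\}$. *)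

theory Defs
  imports "HOL-Analysis.Analysis" "HOL-Library.Extended" "HOL-Library.Lub_Glb"
begin

section \<open>First-order expansions of an ordered group\<close>

text \<open>
  The underlying ordered group is the type \<open>'a\<close> itself; a structure adds to
  \<open><\<close>, \<open>+\<close>, \<open>0\<close> an arbitrary family of functions and relations, indexed by the symbols in
  \<open>'f\<close> and \<open>'r\<close>. The interpretations are only ever applied to argument lists whose length is
  the arity of the symbol.
\<close>

record ('a, 'f, 'r) expansion =
  fun_arity :: "'f \<Rightarrow> nat"
  rel_arity :: "'r \<Rightarrow> nat"
  fun_interp :: "'f \<Rightarrow> 'a list \<Rightarrow> 'a"
  rel_interp :: "'r \<Rightarrow> 'a list \<Rightarrow> bool"

text \<open>\<open>Par c\<close> is the constant naming the element \<open>c\<close>, i.e. a parameter.\<close>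

datatype ('a, 'f) tm =
    Var nat
  | Par 'a
  | Zero
  | Add "('a, 'f) tm" "('a, 'f) tm"
  | Fn 'f "('a, 'f) tm list"

datatype ('a, 'f, 'r) fm =
    Eq "('a, 'f) tm" "('a, 'f) tm"
  | Less "('a, 'f) tm" "('a, 'f) tm"
  | Rel 'r "('a, 'f) tm list"
  | Neg "('a, 'f, 'r) fm"
  | Conj "('a, 'f, 'r) fm" "('a, 'f, 'r) fm"
  | Exi nat "('a, 'f, 'r) fm"

primrec wf_tm :: "('a, 'f, 'r) expansion \<Rightarrow> ('a, 'f) tm \<Rightarrow> bool" where
  "wf_tm M (Var i) = True"
| "wf_tm M (Par c) = True"
| "wf_tm M Zero = True"
| "wf_tm M (Add s t) = (wf_tm M s \<and> wf_tm M t)"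
| "wf_tm M (Fn f ts) = (length ts = fun_arity M f \<and> list_all (\<lambda>b. b) (map (wf_tm M) ts))"

primrec wf_fm :: "('a, 'f, 'r) expansion \<Rightarrow> ('a, 'f, 'r) fm \<Rightarrow> bool" where
  "wf_fm M (Eq s t) = (wf_tm M s \<and> wf_tm M t)"
| "wf_fm M (Less s t) = (wf_tm M s \<and> wf_tm M t)"
| "wf_fm M (Rel r ts) = (length ts = rel_arity M r \<and> list_all (wf_tm M) ts)"
| "wf_fm M (Neg p) = wf_fm M p"
| "wf_fm M (Conj p q) = (wf_fm M p \<and> wf_fm M q)"
| "wf_fm M (Exi i p) = wf_fm M p"

primrec fv_tm :: "('a, 'f) tm \<Rightarrow> nat set" where
  "fv_tm (Var i) = {i}"
| "fv_tm (Par c) = {}"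
| "fv_tm Zero = {}"
| "fv_tm (Add s t) = fv_tm s \<union> fv_tm t"
| "fv_tm (Fn f ts) = \<Union> (set (map fv_tm ts))"

primrec fv_fm :: "('a, 'f, 'r) fm \<Rightarrow> nat set" where
  "fv_fm (Eq s t) = fv_tm s \<union> fv_tm t"
| "fv_fm (Less s t) = fv_tm s \<union> fv_tm t"
| "fv_fm (Rel r ts) = \<Union> (set (map fv_tm ts))"
| "fv_fm (Neg p) = fv_fm p"
| "fv_fm (Conj p q) = fv_fm p \<union> fv_fm q"
| "fv_fm (Exi i p) = fv_fm p - {i}"

primrec eval_tm ::
  "('a::linordered_ab_group_add, 'f, 'r) expansion \<Rightarrow> (nat \<Rightarrow> 'a) \<Rightarrow> ('a, 'f) tm \<Rightarrow> 'a" where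
  "eval_tm M v (Var i) = v i"
| "eval_tm M v (Par c) = c"
| "eval_tm M v Zero = 0"
| "eval_tm M v (Add s t) = eval_tm M v s + eval_tm M v t"
| "eval_tm M v (Fn f ts) = fun_interp M f (map (eval_tm M v) ts)"

primrec sat ::
  "('a::linordered_ab_group_add, 'f, 'r) expansion \<Rightarrow> (nat \<Rightarrow> 'a) \<Rightarrow> ('a, 'f, 'r) fm \<Rightarrow> bool" where
  "sat M v (Eq s t) \<longleftrightarrow> eval_tm M v s = eval_tm M v t"
| "sat M v (Less s t) \<longleftrightarrow> eval_tm M v s < eval_tm M v t"
| "sat M v (Rel r ts) \<longleftrightarrow> rel_interp M r (map (eval_tm M v) ts)"
| "sat M v (Neg p) \<longleftrightarrow> \<not> sat M v p"
| "sat M v (Conj p q) \<longleftrightarrow> sat M v p \<and> sat M v q"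
| "sat M v (Exi i p) \<longleftrightarrow> (\<exists>a. sat M (v(i := a)) p)"


section \<open>Definable sets and functions\<close>

text \<open>
  The power \<open>M\<^sup>n\<close> consists of the functions that are extensional on \<open>{..<n}\<close>. In these terms
  the point \<open>(y, x)\<close> of \<open>M\<^sup>n\<^sup>+\<^sup>1\<close>, for \<open>y\<close> in \<open>M\<^sup>n\<close> and \<open>x\<close> in \<open>M\<close>, is \<open>y(n := x)\<close>.
\<close>

definition pow :: "nat \<Rightarrow> (nat \<Rightarrow> 'a) set" where
  "pow n = {..<n} \<rightarrow>\<^sub>E UNIV"

definition definable ::
  "('a::linordered_ab_group_add, 'f, 'r) expansion \<Rightarrow> nat \<Rightarrow> (nat \<Rightarrow> 'a) set \<Rightarrow> bool" where
  "definable M n X \<longleftrightarrow>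
     (\<exists>p. wf_fm M p \<and> fv_fm p \<subseteq> {..<n} \<and> X = {x \<in> pow n. sat M x p})"

definition definable1 :: "('a::linordered_ab_group_add, 'f, 'r) expansion \<Rightarrow> 'a set \<Rightarrow> bool" where
  "definable1 M X \<longleftrightarrow> definable M 1 {x \<in> pow 1. x 0 \<in> X}"

definition definable_fun ::
  "('a::linordered_ab_group_add, 'f, 'r) expansion \<Rightarrow> nat \<Rightarrow> (nat \<Rightarrow> 'a) set
     \<Rightarrow> ((nat \<Rightarrow> 'a) \<Rightarrow> 'a) \<Rightarrow> bool" where
  "definable_fun M n A f \<longleftrightarrow> definable M (Suc n) {y(n := f y) |y. y \<in> A}"

definition definable_fun1 ::
  "('a::linordered_ab_group_add, 'f, 'r) expansion \<Rightarrow> 'a set \<Rightarrow> ('a \<Rightarrow> 'a) \<Rightarrow> bool" where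
  "definable_fun1 M I f \<longleftrightarrow> definable M 2 {z \<in> pow 2. z 0 \<in> I \<and> z 1 = f (z 0)}"


section \<open>Intervals and boxes\<close>

text \<open>
  An interval with \<open>b \<le> a\<close> is empty. In a nontrivial group every unbounded open interval is
  nonempty.
\<close>

definition bounded_open_interval :: "'a::linorder set \<Rightarrow> bool" where
  "bounded_open_interval I \<longleftrightarrow> (\<exists>a b. I = {a<..<b})"

definition unbounded_open_interval :: "'a::linorder set \<Rightarrow> bool" where
  "unbounded_open_interval I \<longleftrightarrow> (\<exists>a. I = {a<..}) \<or> (\<exists>b. I = {..<b}) \<or> I = UNIV"

definition open_interval :: "'a::linorder set \<Rightarrow> bool" where
  "open_interval I \<longleftrightarrow> bounded_open_interval I \<or> unbounded_open_interval I"

definition open_box :: "nat \<Rightarrow> (nat \<Rightarrow> 'a::linorder) set \<Rightarrow> bool" where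
  "open_box n B \<longleftrightarrow> (\<exists>J. (\<forall>i<n. open_interval (J i)) \<and> B = (\<Pi>\<^sub>E i\<in>{..<n}. J i))"

definition finite_union_points_intervals :: "'a::linorder set \<Rightarrow> bool" where
  "finite_union_points_intervals X \<longleftrightarrow>
     (\<exists>P \<I>. finite P \<and> finite \<I> \<and> (\<forall>I\<in>\<I>. open_interval I) \<and> X = P \<union> \<Union>\<I>)"


section \<open>Tameness conditions\<close>

definition definably_complete ::
  "('a::linordered_ab_group_add, 'f, 'r) expansion \<Rightarrow> bool" where
  "definably_complete M \<longleftrightarrow>
     (\<forall>X. definable1 M X \<longrightarrow>
        (\<exists>s. isLub UNIV (Fin ` X) s) \<and> (\<exists>t. isGlb UNIV (Fin ` X) t))"

definition unif_locally_o_minimal_2nd ::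
  "('a::linordered_ab_group_add, 'f, 'r) expansion \<Rightarrow> bool" where
  "unif_locally_o_minimal_2nd M \<longleftrightarrow>
     (\<forall>n X a b. definable M (Suc n) X \<and> b \<in> pow n \<longrightarrow>
        (\<exists>I B. open_interval I \<and> a \<in> I \<and> open_box n B \<and> b \<in> B \<and>
           (\<forall>y\<in>B. finite_union_points_intervals ({x. y(n := x) \<in> X} \<inter> I))))"

definition DCULOAS ::
  "('a::{linordered_ab_group_add,dense_linorder}, 'f, 'r) expansion \<Rightarrow> bool" where
  "DCULOAS M \<longleftrightarrow> definably_complete M \<and> unif_locally_o_minimal_2nd M"

definition archimedean ::
  "('a::linordered_ab_group_add, 'f, 'r) expansion \<Rightarrow> bool" where
  "archimedean M \<longleftrightarrow> (\<forall>a b::'a. 0 < a \<and> 0 < b \<longrightarrow> (\<exists>n\<ge>1. b < (\<Sum>i<(n::nat). a)))"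

definition o_minimal :: "('a::linordered_ab_group_add, 'f, 'r) expansion \<Rightarrow> bool" where
  "o_minimal M \<longleftrightarrow> (\<forall>X. definable1 M X \<longrightarrow> finite_union_points_intervals X)"


section \<open>Topology\<close>

text \<open>
  The sort \<open>linorder_topology\<close> makes \<open>euclidean\<close> on \<open>'a\<close> the order topology.
\<close>

definition pow_topology :: "nat \<Rightarrow> (nat \<Rightarrow> 'a::linorder_topology) topology" where
  "pow_topology n = product_topology (\<lambda>i. euclidean) {..<n}"

definition definable_Tietze ::
  "('a::{linordered_ab_group_add,linorder_topology}, 'f, 'r) expansion \<Rightarrow> bool" where
  "definable_Tietze M \<longleftrightarrow>
     (\<forall>n\<ge>1. \<forall>A f.
        definable M n A \<and> closedin (pow_topology n) A \<and>
        definable_fun M n A f \<and> continuous_map (subtopology (pow_topology n) A) euclidean f \<longrightarrow>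
        (\<exists>F. definable_fun M n (pow n) F \<and> continuous_map (pow_topology n) euclidean F \<and>
             (\<forall>x\<in>A. F x = f x)))"

end

theory Submission
  imports Defs
begin

text \<open>
  Fix \<open>u > 0\<close> and let \<open>G x t\<close> be a Tietze extension of the function that is \<open>0\<close> on the line \<open>t = 0\<close>
  and \<open>x\<close> on the line \<open>t = u\<close>. Each \<open>G x\<close> is uniformly continuous on \<open>{0..u}\<close>, but by the archimedean
  property its modulus of continuity must tend to \<open>0\<close> as \<open>x\<close> tends to minus infinity. This yields a
  definable positive nondecreasing function \<open>k\<close> near minus infinity with limit \<open>0\<close>.

  The boundary of a definable set is closed and discrete, and by definable completeness and the
  archimedean property it is finite on bounded intervals. Were it infinite, then, up to a reflection,
  \<open>k\<close> would map it to a definable set accumulating at \<open>0\<close> without containing an interval, which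
  contradicts local o-minimality at \<open>0\<close>. So the structure is o-minimal. The range of \<open>k\<close> contains some
  \<open>{0<..<e}\<close>, and the supremum of the fibre of \<open>k\<close> over \<open>c\<close> is a strictly increasing function of \<open>c\<close>
  with unbounded range; by o-minimality that range contains a half-line.
\<close>

section \<open>A calculus of definable predicates\<close>

lemma eval_tm_cong:
  "(\<And>i. i \<in> fv_tm t \<Longrightarrow> v i = w i) \<Longrightarrow> eval_tm M v t = eval_tm M w t"
proof (induction t)
  case (Fn f ts)
  have "map (eval_tm M v) ts = map (eval_tm M w) ts"
    using Fn by (intro map_cong) auto
  then show ?case by (simp only: eval_tm.simps)
qed auto

lemma sat_cong:
  "(\<And>i. i \<in> fv_fm p \<Longrightarrow> v i = w i) \<Longrightarrow> sat M v p = sat M w p"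
proof (induction p arbitrary: v w)
  case (Eq s t)
  then show ?case using eval_tm_cong[of s v w M] eval_tm_cong[of t v w M] by simp
next
  case (Less s t)
  then show ?case using eval_tm_cong[of s v w M] eval_tm_cong[of t v w M] by simp
next
  case (Rel r ts)
  have "map (eval_tm M v) ts = map (eval_tm M w) ts"
    using Rel by (intro map_cong refl eval_tm_cong) auto
  then show ?case by (simp only: sat.simps)
next
  case (Exi i p)
  have "sat M (v(i := a)) p = sat M (w(i := a)) p" for a
    by (rule Exi.IH) (simp add: Exi.prems)
  then show ?case by (simp only: sat.simps)
next
  case (Conj p q)
  have "sat M v p = sat M w p" "sat M v q = sat M w q"
    by (rule Conj.IH; simp add: Conj.prems)+
  then show ?case by simp
next
  case (Neg p)
  have "sat M v p = sat M w p"
    by (rule Neg.IH) (simp add: Neg.prems)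
  then show ?case by simp
qed

primrec ren_tm :: "(nat \<Rightarrow> nat) \<Rightarrow> ('a, 'f) tm \<Rightarrow> ('a, 'f) tm" where
  "ren_tm \<pi> (Var i) = Var (\<pi> i)"
| "ren_tm \<pi> (Par c) = Par c"
| "ren_tm \<pi> Zero = Zero"
| "ren_tm \<pi> (Add s t) = Add (ren_tm \<pi> s) (ren_tm \<pi> t)"
| "ren_tm \<pi> (Fn f ts) = Fn f (map (ren_tm \<pi>) ts)"

primrec ren_fm :: "(nat \<Rightarrow> nat) \<Rightarrow> ('a, 'f, 'r) fm \<Rightarrow> ('a, 'f, 'r) fm" where
  "ren_fm \<pi> (Eq s t) = Eq (ren_tm \<pi> s) (ren_tm \<pi> t)"
| "ren_fm \<pi> (Less s t) = Less (ren_tm \<pi> s) (ren_tm \<pi> t)"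
| "ren_fm \<pi> (Rel r ts) = Rel r (map (ren_tm \<pi>) ts)"
| "ren_fm \<pi> (Neg p) = Neg (ren_fm \<pi> p)"
| "ren_fm \<pi> (Conj p q) = Conj (ren_fm \<pi> p) (ren_fm \<pi> q)"
| "ren_fm \<pi> (Exi i p) = Exi (\<pi> i) (ren_fm \<pi> p)"

lemma eval_ren_tm: "eval_tm M v (ren_tm \<pi> t) = eval_tm M (v \<circ> \<pi>) t"
proof (induction t)
  case (Fn f ts)
  have "map (eval_tm M v) (map (ren_tm \<pi>) ts) = map (eval_tm M (v \<circ> \<pi>)) ts"
    unfolding map_map by (intro map_cong) (simp_all only: comp_def Fn.IH)
  then show ?case by (simp only: eval_tm.simps ren_tm.simps)
qed auto

text \<open>Bound variables are renamed along with the free ones, so injectivity of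
  \<open>\<pi>\<close> is what rules out capture at a quantifier.\<close>

lemma sat_ren_fm: "inj \<pi> \<Longrightarrow> sat M v (ren_fm \<pi> p) = sat M (v \<circ> \<pi>) p"
proof (induction p arbitrary: v)
  case (Rel r ts)
  have "map (eval_tm M v) (map (ren_tm \<pi>) ts) = map (eval_tm M (v \<circ> \<pi>)) ts"
    by (simp add: eval_ren_tm)
  then show ?case by (simp only: sat.simps ren_fm.simps)
next
  case (Exi i p)
  have "v(\<pi> i := a) \<circ> \<pi> = (v \<circ> \<pi>)(i := a)" for a
    using Exi.prems by (auto simp: fun_eq_iff inj_eq)
  then show ?case using Exi by (simp only: sat.simps ren_fm.simps)
qed (simp_all add: eval_ren_tm)

lemma wf_ren_tm: "wf_tm M t \<Longrightarrow> wf_tm M (ren_tm \<pi> t)"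
  by (induction t) (auto simp: list_all_iff)

lemma wf_ren_fm: "wf_fm M p \<Longrightarrow> wf_fm M (ren_fm \<pi> p)"
  by (induction p) (auto simp: list_all_iff wf_ren_tm)

lemma fv_ren_tm: "fv_tm (ren_tm \<pi> t) = \<pi> ` fv_tm t"
  by (induction t) auto

lemma fv_ren_fm: "inj \<pi> \<Longrightarrow> fv_fm (ren_fm \<pi> p) = \<pi> ` fv_fm p"
  by (induction p) (auto simp: fv_ren_tm image_set_diff)

text \<open>A predicate on all assignments rather than on \<open>pow n\<close>: no extensionality
  conditions arise, and the closure rules below can be applied by unification without writing
  formulas.\<close>

definition definable_pred ::
  "('a::linordered_ab_group_add, 'f, 'r) expansion \<Rightarrow> nat \<Rightarrow> ((nat \<Rightarrow> 'a) \<Rightarrow> bool) \<Rightarrow> bool" where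
  "definable_pred M n Q \<longleftrightarrow>
     (\<exists>p. wf_fm M p \<and> fv_fm p \<subseteq> {..<n} \<and> (\<forall>v. sat M v p = Q v))"

definition definable_term ::
  "('a::linordered_ab_group_add, 'f, 'r) expansion \<Rightarrow> nat \<Rightarrow> ((nat \<Rightarrow> 'a) \<Rightarrow> 'a) \<Rightarrow> bool" where
  "definable_term M n f \<longleftrightarrow>
     (\<exists>t. wf_tm M t \<and> fv_tm t \<subseteq> {..<n} \<and> (\<forall>v. eval_tm M v t = f v))"

lemma definable_pred_cong:
  assumes "definable_pred M n Q" "\<And>i. i < n \<Longrightarrow> v i = w i"
  shows "Q v = Q w"
proof -
  obtain p where p: "fv_fm p \<subseteq> {..<n}" "\<And>v. sat M v p = Q v"
    using assms(1) by (auto simp: definable_pred_def)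
  have "sat M v p = sat M w p"
    using p(1) assms(2) by (intro sat_cong) auto
  then show ?thesis by (simp add: p)
qed

lemma definable_term_cong:
  assumes "definable_term M n f" "\<And>i. i < n \<Longrightarrow> v i = w i"
  shows "f v = f w"
proof -
  obtain t where t: "fv_tm t \<subseteq> {..<n}" "\<And>v. eval_tm M v t = f v"
    using assms(1) by (auto simp: definable_term_def)
  have "eval_tm M v t = eval_tm M w t"
    using t(1) assms(2) by (intro eval_tm_cong) auto
  then show ?thesis by (simp add: t)
qed

lemma definable_term_mono: "definable_term M n f \<Longrightarrow> n \<le> m \<Longrightarrow> definable_term M m f"
  unfolding definable_term_def by (meson lessThan_subset_iff subset_trans)

lemma definable_term_var: "i < n \<Longrightarrow> definable_term M n (\<lambda>v. v i)"
  unfolding definable_term_def by (rule exI[of _ "Var i"]) auto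

lemma definable_term_const: "definable_term M n (\<lambda>v. c)"
  unfolding definable_term_def by (rule exI[of _ "Par c"]) auto

lemma definable_term_add:
  assumes "definable_term M n f" "definable_term M n g"
  shows "definable_term M n (\<lambda>v. f v + g v)"
proof -
  obtain s t where "wf_tm M s" "fv_tm s \<subseteq> {..<n}" "\<And>v. eval_tm M v s = f v"
    "wf_tm M t" "fv_tm t \<subseteq> {..<n}" "\<And>v. eval_tm M v t = g v"
    using assms by (auto simp: definable_term_def)
  then show ?thesis
    unfolding definable_term_def by (intro exI[of _ "Add s t"]) auto
qed

lemma definable_pred_eq:
  assumes "definable_term M n f" "definable_term M n g"
  shows "definable_pred M n (\<lambda>v. f v = g v)"
proof -
  obtain s t where "wf_tm M s" "fv_tm s \<subseteq> {..<n}" "\<And>v. eval_tm M v s = f v"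
    "wf_tm M t" "fv_tm t \<subseteq> {..<n}" "\<And>v. eval_tm M v t = g v"
    using assms by (auto simp: definable_term_def)
  then show ?thesis
    unfolding definable_pred_def by (intro exI[of _ "Eq s t"]) auto
qed

lemma definable_pred_less:
  assumes "definable_term M n f" "definable_term M n g"
  shows "definable_pred M n (\<lambda>v. f v < g v)"
proof -
  obtain s t where "wf_tm M s" "fv_tm s \<subseteq> {..<n}" "\<And>v. eval_tm M v s = f v"
    "wf_tm M t" "fv_tm t \<subseteq> {..<n}" "\<And>v. eval_tm M v t = g v"
    using assms by (auto simp: definable_term_def)
  then show ?thesis
    unfolding definable_pred_def by (intro exI[of _ "Less s t"]) auto
qed

lemma definable_pred_not:
  assumes "definable_pred M n P"
  shows "definable_pred M n (\<lambda>v. \<not> P v)"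
proof -
  obtain p where "wf_fm M p" "fv_fm p \<subseteq> {..<n}" "\<And>v. sat M v p = P v"
    using assms by (auto simp: definable_pred_def)
  then show ?thesis
    unfolding definable_pred_def by (intro exI[of _ "Neg p"]) auto
qed

lemma definable_pred_conj:
  assumes "definable_pred M n P" "definable_pred M n Q"
  shows "definable_pred M n (\<lambda>v. P v \<and> Q v)"
proof -
  obtain p q where "wf_fm M p" "fv_fm p \<subseteq> {..<n}" "\<And>v. sat M v p = P v"
    "wf_fm M q" "fv_fm q \<subseteq> {..<n}" "\<And>v. sat M v q = Q v"
    using assms by (auto simp: definable_pred_def)
  then show ?thesis
    unfolding definable_pred_def by (intro exI[of _ "Conj p q"]) auto
qed

lemma definable_pred_le:
  assumes "definable_term M n f" "definable_term M n g"
  shows "definable_pred M n (\<lambda>v. f v \<le> g v)"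
  unfolding not_less[symmetric] by (intro definable_pred_not definable_pred_less assms)

lemma definable_pred_disj:
  assumes "definable_pred M n P" "definable_pred M n Q"
  shows "definable_pred M n (\<lambda>v. P v \<or> Q v)"
proof -
  have "definable_pred M n (\<lambda>v. \<not> (\<not> P v \<and> \<not> Q v))"
    by (intro definable_pred_not definable_pred_conj assms)
  then show ?thesis by simp
qed

lemma definable_pred_imp:
  assumes "definable_pred M n P" "definable_pred M n Q"
  shows "definable_pred M n (\<lambda>v. P v \<longrightarrow> Q v)"
  unfolding imp_conv_disj by (intro definable_pred_disj definable_pred_not assms)

text \<open>
  The variable bound by the quantifier is \<open>v n\<close>; the second premise says that the matrix does not
  otherwise depend on it. In this form the rules can be applied by unification.
\<close>

lemma definable_pred_ex:
  assumes "definable_pred M (Suc n) (\<lambda>v. Q (v n) v)"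
    and indep: "\<And>a v b. Q a (v(n := b)) = Q a v"
  shows "definable_pred M n (\<lambda>v. \<exists>a. Q a v)"
proof -
  obtain p where "wf_fm M p" "fv_fm p \<subseteq> {..<Suc n}" "\<And>v. sat M v p = Q (v n) v"
    using assms(1) by (auto simp: definable_pred_def)
  moreover from this have "fv_fm p - {n} \<subseteq> {..<n}"
    by (force simp: less_Suc_eq)
  ultimately show ?thesis
    unfolding definable_pred_def by (intro exI[of _ "Exi n p"]) (auto simp: indep)
qed

lemma definable_pred_all:
  assumes "definable_pred M (Suc n) (\<lambda>v. Q (v n) v)"
    and "\<And>a v b. Q a (v(n := b)) = Q a v"
  shows "definable_pred M n (\<lambda>v. \<forall>a. Q a v)"
proof -
  have "definable_pred M n (\<lambda>v. \<not> (\<exists>a. \<not> Q a v))"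
    by (intro definable_pred_not definable_pred_ex assms(1)) (simp add: assms(2))
  then show ?thesis by simp
qed

section \<open>Substitution of terms into predicates\<close>

lemma definable_pred_shift:
  assumes "definable_pred M k Q"
  shows "definable_pred M (n + k) (\<lambda>v. Q (\<lambda>i. v (n + i)))"
proof -
  obtain p where "wf_fm M p" "fv_fm p \<subseteq> {..<k}" "\<And>v. sat M v p = Q v"
    using assms by (auto simp: definable_pred_def)
  moreover have "inj (\<lambda>i. n + i)" by (auto simp: inj_on_def)
  ultimately show ?thesis
    unfolding definable_pred_def
    by (intro exI[of _ "ren_fm (\<lambda>i. n + i) p"]) (auto simp: wf_ren_fm fv_ren_fm sat_ren_fm comp_def)
qed

text \<open>No syntactic substitution is performed. The variables of \<open>Q\<close> are first
  moved to the places \<open>n\<close>, \<open>n + 1\<close>, ..., away from those of the terms;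
  then each is quantified away, since \<open>Q\<close> holds at \<open>t\<close> iff some
  \<open>a\<close> satisfies \<open>a = t\<close> and \<open>Q\<close> holds at
  \<open>a\<close>.\<close>

lemma definable_pred_subst:
  assumes Q: "definable_pred M k Q" and t: "\<And>i. definable_term M n (t i)"
  shows "definable_pred M n (\<lambda>v. Q (\<lambda>i. t i v))"
proof -
  have indep: "t i (v(n + j := b)) = t i v" for i j v b
    by (rule definable_term_cong[OF t]) auto
  \<comment> \<open>The first \<open>j\<close> arguments are still variables, the others are already
    terms. Downward induction leads from the shifted predicate (\<open>j = k\<close>) to the goal
    (\<open>j = 0\<close>).\<close>
  have "definable_pred M (n + j) (\<lambda>v. Q (\<lambda>i. if i < j then v (n + i) else t i v))" if "j \<le> k" for j
    using that
  proof (induction j rule: inc_induct)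
    case base
    have "Q (\<lambda>i. if i < k then v (n + i) else t i v) = Q (\<lambda>i. v (n + i))" for v
      by (rule definable_pred_cong[OF Q]) auto
    then show ?case using definable_pred_shift[OF Q] by simp
  next
    case (step j)
    let ?R = "\<lambda>a v. a = t j v \<and> Q (\<lambda>i. if i < j then v (n + i) else if i = j then a else t i v)"
    have "definable_pred M (Suc (n + j)) (\<lambda>v. v (n + j) = t j v \<and>
        Q (\<lambda>i. if i < Suc j then v (n + i) else t i v))"
    proof (rule definable_pred_conj)
      show "definable_pred M (Suc (n + j)) (\<lambda>v. v (n + j) = t j v)"
        by (rule definable_pred_eq[OF definable_term_var definable_term_mono[OF t]]) auto
      show "definable_pred M (Suc (n + j)) (\<lambda>v. Q (\<lambda>i. if i < Suc j then v (n + i) else t i v))"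
        using step.IH by (simp only: add_Suc_right)
    qed
    moreover have "(\<lambda>i. if i < Suc j then v (n + i) else t i v) =
        (\<lambda>i. if i < j then v (n + i) else if i = j then v (n + j) else t i v)" for v
      by (auto simp: fun_eq_iff less_Suc_eq)
    ultimately have "definable_pred M (Suc (n + j)) (\<lambda>v. ?R (v (n + j)) v)"
      by simp
    moreover have "?R a (v(n + j := b)) = ?R a v" for a v b
    proof -
      have "(\<lambda>i. if i < j then (v(n + j := b)) (n + i) else if i = j then a else t i (v(n + j := b))) =
        (\<lambda>i. if i < j then v (n + i) else if i = j then a else t i v)"
        by (auto simp: fun_eq_iff indep)
      then show ?thesis by (simp only: indep)
    qed
    ultimately have "definable_pred M (n + j) (\<lambda>v. \<exists>a. ?R a v)"
      by (rule definable_pred_ex)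
    moreover have "(\<lambda>i. if i < j then v (n + i) else if i = j then t j v else t i v) =
        (\<lambda>i. if i < j then v (n + i) else t i v)" for v
      by (auto simp: fun_eq_iff)
    ultimately show ?case by simp
  qed
  from this[of 0] show ?thesis by simp
qed

lemma definable_pred_subst1:
  assumes "definable_pred M 1 (\<lambda>v. R (v 0))" "definable_term M n s"
  shows "definable_pred M n (\<lambda>v. R (s v))"
  using definable_pred_subst[OF assms(1), of n "\<lambda>i. s"] assms(2) by simp

lemma definable_pred_subst2:
  assumes "definable_pred M 2 (\<lambda>v. R (v 0) (v 1))" "definable_term M n s" "definable_term M n t"
  shows "definable_pred M n (\<lambda>v. R (s v) (t v))"
  using definable_pred_subst[OF assms(1), of n "\<lambda>i. if i = 0 then s else t"] assms(2,3) by simp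

lemma definable_pred_subst3:
  assumes "definable_pred M 3 (\<lambda>v. R (v 0) (v 1) (v 2))"
    "definable_term M n s" "definable_term M n t" "definable_term M n r"
  shows "definable_pred M n (\<lambda>v. R (s v) (t v) (r v))"
  using definable_pred_subst[OF assms(1), of n "\<lambda>i. if i = 0 then s else if i = 1 then t else r"]
    assms(2-4) by simp

lemmas definable_intros =
  definable_term_var definable_term_const definable_term_add
  definable_pred_eq definable_pred_less definable_pred_le definable_pred_not definable_pred_conj
  definable_pred_disj definable_pred_imp definable_pred_ex definable_pred_all

section \<open>Definable sets and functions as definable predicates\<close>

lemma definable_of_pred: "definable_pred M n Q \<Longrightarrow> definable M n {x \<in> pow n. Q x}"
  unfolding definable_pred_def definable_def by blast

lemma definable_pred_of:
  assumes "definable M n X"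
  shows "definable_pred M n (\<lambda>v. restrict v {..<n} \<in> X)"
proof -
  obtain p where p: "wf_fm M p" "fv_fm p \<subseteq> {..<n}" and X: "X = {x \<in> pow n. sat M x p}"
    using assms by (auto simp: definable_def)
  have "sat M (restrict v {..<n}) p = sat M v p" for v
    using p(2) by (intro sat_cong) auto
  then have "sat M v p = (restrict v {..<n} \<in> X)" for v
    by (simp add: X pow_def)
  with p show ?thesis unfolding definable_pred_def by blast
qed

lemma definable1_iff: "definable1 M X \<longleftrightarrow> definable_pred M 1 (\<lambda>v. v 0 \<in> X)"
proof
  assume "definable1 M X"
  from definable_pred_of[OF this[unfolded definable1_def]]
  show "definable_pred M 1 (\<lambda>v. v 0 \<in> X)" by (simp add: pow_def)
qed (simp add: definable1_def definable_of_pred)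

lemma definable_fun1_iff:
  "definable_fun1 M I f \<longleftrightarrow> definable_pred M 2 (\<lambda>v. v 0 \<in> I \<and> v 1 = f (v 0))"
proof
  assume "definable_fun1 M I f"
  from definable_pred_of[OF this[unfolded definable_fun1_def]]
  show "definable_pred M 2 (\<lambda>v. v 0 \<in> I \<and> v 1 = f (v 0))" by (simp add: pow_def)
qed (simp add: definable_fun1_def definable_of_pred)

lemma definable1_Compl: "definable1 M X \<Longrightarrow> definable1 M (- X)"
  unfolding definable1_iff using definable_pred_not by fastforce

lemma definable1_in: "definable1 M X \<Longrightarrow> definable_term M n s \<Longrightarrow> definable_pred M n (\<lambda>v. s v \<in> X)"
  unfolding definable1_iff by (rule definable_pred_subst1)

section \<open>Completeness and local o-minimality in one variable\<close>

text \<open>A first-order relation between elements of the group, so that suprema of fibres can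
  occur inside definable predicates.\<close>

definition is_sup :: "'a::linorder set \<Rightarrow> 'a \<Rightarrow> bool" where
  "is_sup X s \<longleftrightarrow> (\<forall>x\<in>X. x \<le> s) \<and> (\<forall>z. (\<forall>x\<in>X. x \<le> z) \<longrightarrow> s \<le> z)"

lemma is_sup_unique: "is_sup X s \<Longrightarrow> is_sup X t \<Longrightarrow> s = t"
  by (auto simp: is_sup_def intro: antisym)

lemma definable_pred_is_sup:
  assumes R: "definable_pred M 2 (\<lambda>v. R (v 0) (v 1))"
    and s: "definable_term M n s" and t: "definable_term M n t"
  shows "definable_pred M n (\<lambda>v. is_sup {y. R (s v) y} (t v))"
proof -
  have "definable_pred M 2 (\<lambda>v. (\<forall>y. R (v 0) y \<longrightarrow> y \<le> v 1) \<and>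
      (\<forall>z. (\<forall>y. R (v 0) y \<longrightarrow> y \<le> z) \<longrightarrow> v 1 \<le> z))"
    by (intro definable_intros definable_pred_subst2[OF R]) auto
  from definable_pred_subst2[OF this s t] show ?thesis
    by (simp add: is_sup_def)
qed

text \<open>The extended supremum lies between \<open>Fin x\<close> and \<open>Fin b\<close>, hence
  is an element of the group.\<close>

lemma ex_is_sup:
  assumes "definably_complete M" "definable1 M X" "x \<in> X" "\<And>y. y \<in> X \<Longrightarrow> y \<le> b"
  shows "\<exists>s. is_sup X s"
proof -
  obtain s where s: "isLub UNIV (Fin ` X) s"
    using assms(1,2) by (auto simp: definably_complete_def)
  then have up: "\<And>y. y \<in> X \<Longrightarrow> Fin y \<le> s"
    and least: "\<And>z. (\<And>y. y \<in> X \<Longrightarrow> Fin y \<le> z) \<Longrightarrow> s \<le> z"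
    by (auto simp: isLub_def leastP_def isUb_def setle_def setge_def)
  have "Fin x \<le> s" "s \<le> Fin b"
    using up least assms(3,4) by auto
  then obtain t where "s = Fin t"
    by (cases s) auto
  have "x \<le> t" if "x \<in> X" for x
    using up[OF that] \<open>s = Fin t\<close> by simp
  moreover have "t \<le> z" if "\<forall>x\<in>X. x \<le> z" for z
    using least[of "Fin z"] that \<open>s = Fin t\<close> by simp
  ultimately have "is_sup X t"
    by (simp add: is_sup_def)
  then show ?thesis ..
qed

text \<open>
  The one-variable substitute for compactness of \<open>{p..q}\<close>: \<open>Q z\<close> stands for a property of the
  interval \<open>{p..z}\<close> that extends a little beyond every limit point.
\<close>

lemma definable_induction:
  fixes M :: "('a::{linordered_ab_group_add,dense_linorder}, 'f, 'r) expansion"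
  assumes "definably_complete M" and Q: "definable_pred M 1 (\<lambda>v. Q (v 0))"
    and "p \<le> q" "Q p"
    and step: "\<And>s. p \<le> s \<Longrightarrow> s \<le> q \<Longrightarrow> \<exists>e>0. \<forall>z z'. p \<le> z \<and> z \<le> s \<and> s < z + e \<and> s \<le> z' \<and>
      z' < s + e \<and> z' \<le> q \<and> Q z \<longrightarrow> Q z'"
  shows "Q q"
proof -
  let ?X = "{z. p \<le> z \<and> z \<le> q \<and> Q z}"
    have X: "definable1 M ?X"
    unfolding definable1_iff mem_Collect_eq
    by (intro definable_intros Q) auto
  have p: "p \<in> ?X"
    using assms(3,4) by simp
  then obtain s where s: "is_sup ?X s"
    using ex_is_sup[OF assms(1) X p, of q] by blast
  have ps: "p \<le> s" "s \<le> q"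
    using s p by (simp_all add: is_sup_def)
  from step[OF this] obtain e where e: "0 < e"
    and ext: "\<And>z z'. p \<le> z \<Longrightarrow> z \<le> s \<Longrightarrow> s < z + e \<Longrightarrow> s \<le> z' \<Longrightarrow> z' < s + e \<Longrightarrow> z' \<le> q \<Longrightarrow> Q z \<Longrightarrow> Q z'"
    by blast
  \<comment> \<open>Otherwise \<open>s - e\<close> would be a smaller upper bound. From such a
    \<open>z\<close> the property is carried past \<open>s\<close>, which forces
    \<open>s = q\<close>.\<close>
  have "\<exists>z\<in>?X. s < z + e"
  proof (rule ccontr)
    assume "\<not> ?thesis"
    then have "\<forall>z\<in>?X. z \<le> s - e"
      by (auto simp: not_less le_diff_eq)
    then have "s \<le> s - e"
      using s by (simp add: is_sup_def)
    with e show False by simp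
  qed
  then obtain z where z: "p \<le> z" "z \<le> s" "s < z + e" "Q z"
    using s by (auto simp: is_sup_def)
  have "s = q"
  proof (rule ccontr)
    assume "s \<noteq> q"
    then have "s < min q (s + e)" using ps e by simp
    then obtain z' where z': "s < z'" "z' < min q (s + e)" using dense by blast
    then have "Q z'" using ext[OF z(1-3), of z'] z(4) by (simp add: less_imp_le)
    then have "z' \<in> ?X" using z' ps by auto
    then have "z' \<le> s" using s unfolding is_sup_def by blast
    with z' show False by simp
  qed
  with ext[OF z(1-3), of q] z(4) e show ?thesis by simp
qed

section \<open>Germs of definable sets at a point and at minus infinity\<close>

text \<open>On \<open>Y\<close> the filter behaves like an ultrafilter. The decided sets form a
  Boolean algebra, so it suffices to decide the open rays.\<close>

definition decided :: "'a filter \<Rightarrow> 'a set \<Rightarrow> bool" where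
  "decided F Y \<longleftrightarrow> eventually (\<lambda>x. x \<in> Y) F \<or> eventually (\<lambda>x. x \<notin> Y) F"

lemma decided_Compl: "decided F Y \<Longrightarrow> decided F (- Y)"
  by (auto simp: decided_def)

lemma decided_Int:
  assumes "decided F Y" "decided F Z"
  shows "decided F (Y \<inter> Z)"
proof -
  consider "eventually (\<lambda>x. x \<in> Y) F" "eventually (\<lambda>x. x \<in> Z) F"
    | "eventually (\<lambda>x. x \<notin> Y) F" | "eventually (\<lambda>x. x \<notin> Z) F"
    using assms by (auto simp: decided_def)
  then show ?thesis
  proof cases
    case 1
    then have "eventually (\<lambda>x. x \<in> Y \<inter> Z) F"
      by (rule eventually_elim2) simp
    then show ?thesis unfolding decided_def ..
  next
    case 2
    then have "eventually (\<lambda>x. x \<notin> Y \<inter> Z) F"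
      by (rule eventually_mono) simp
    then show ?thesis unfolding decided_def ..
  next
    case 3
    then have "eventually (\<lambda>x. x \<notin> Y \<inter> Z) F"
      by (rule eventually_mono) simp
    then show ?thesis unfolding decided_def ..
  qed
qed

lemma decided_Un: "decided F Y \<Longrightarrow> decided F Z \<Longrightarrow> decided F (Y \<union> Z)"
  using decided_Compl[OF decided_Int[OF decided_Compl decided_Compl]] by fastforce

lemma decided_Union: "finite \<Y> \<Longrightarrow> (\<And>Y. Y \<in> \<Y> \<Longrightarrow> decided F Y) \<Longrightarrow> decided F (\<Union>\<Y>)"
  by (induction rule: finite_induct) (simp_all add: decided_Un, simp add: decided_def)

text \<open>Points and open intervals are Boolean combinations of open rays.\<close>

lemma decided_finite_union:
  assumes lt: "\<And>b. decided F {..<b}" and gt: "\<And>b. decided F {b<..}"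
    and Y: "finite_union_points_intervals Y"
  shows "decided F Y"
proof -
  have I: "decided F I" if "open_interval I" for I
  proof -
    have "decided F {a<..<b}" for a b
      using decided_Int[OF gt[of a] lt[of b]] by (simp add: greaterThanLessThan_def)
    moreover have "decided F UNIV" by (simp add: decided_def)
    ultimately show ?thesis
      using that lt gt
      by (auto simp: open_interval_def bounded_open_interval_def unbounded_open_interval_def)
  qed
  have P: "decided F {p}" for p
  proof -
    have "{p} = - ({..<p} \<union> {p<..})" by auto
    then show ?thesis using decided_Compl[OF decided_Un[OF lt gt]] by metis
  qed
  obtain P \<I> where "finite P" "finite \<I>" "\<forall>I\<in>\<I>. open_interval I" and YP: "Y = P \<union> \<Union>\<I>"
    using Y by (auto simp: finite_union_points_intervals_def)
  then have "decided F (\<Union>((\<lambda>p. {p}) ` P \<union> \<I>))"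
    using I P by (intro decided_Union) auto
  also have "\<Union>((\<lambda>p. {p}) ` P \<union> \<I>) = Y" by (auto simp: YP)
  finally show ?thesis .
qed

lemma decided_at_within_locally_o_minimal:
  fixes M :: "('a::{linordered_ab_group_add,dense_linorder,linorder_topology}, 'f, 'r) expansion"
  assumes "unif_locally_o_minimal_2nd M" "definable1 M X"
    and lt: "\<And>b. decided (at a within S) {..<b}" and gt: "\<And>b. decided (at a within S) {b<..}"
  shows "decided (at a within S) X"
proof -
  \<comment> \<open>Uniform local o-minimality is used without parameter variables: this is the only
    point of \<open>pow 0\<close>.\<close>
  let ?y = "\<lambda>_. undefined :: 'a"
  have "definable M (Suc 0) {x \<in> pow 1. x 0 \<in> X}" "?y \<in> pow 0"
    using assms(2) by (auto simp: definable1_def pow_def)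
  then obtain I B where I: "open_interval I" "a \<in> I" and "?y \<in> B"
    and "\<forall>y\<in>B. finite_union_points_intervals ({x. y(0 := x) \<in> {x \<in> pow 1. x 0 \<in> X}} \<inter> I)"
    using assms(1)[unfolded unif_locally_o_minimal_2nd_def, rule_format,
        of 0 "{x \<in> pow 1. x 0 \<in> X}" ?y a] by blast
  then have "finite_union_points_intervals ({x. ?y(0 := x) \<in> {x \<in> pow 1. x 0 \<in> X}} \<inter> I)"
    by blast
  also have "{x. ?y(0 := x) \<in> {x \<in> pow 1. x 0 \<in> X}} = X"
    by (auto simp: pow_def PiE_def extensional_def)
  finally have "decided (at a within S) (X \<inter> I)"
    by (rule decided_finite_union[OF lt gt])
  moreover have "open I"
    using I by (auto simp: open_interval_def bounded_open_interval_def unbounded_open_interval_def)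
  then have "eventually (\<lambda>x. x \<in> I) (at a within S)"
    using I(2) topological_tendstoD[OF tendsto_ident_at] by blast
  ultimately consider "eventually (\<lambda>x. x \<in> X \<inter> I \<and> x \<in> I) (at a within S)"
    | "eventually (\<lambda>x. x \<notin> X \<inter> I \<and> x \<in> I) (at a within S)"
    unfolding decided_def eventually_conj_iff by blast
  then show ?thesis
  proof cases
    case 1
    then have "eventually (\<lambda>x. x \<in> X) (at a within S)"
      by (rule eventually_mono) simp
    then show ?thesis unfolding decided_def ..
  next
    case 2
    then have "eventually (\<lambda>x. x \<notin> X) (at a within S)"
      by (rule eventually_mono) blast
    then show ?thesis unfolding decided_def ..
  qed
qed

text \<open>The point \<open>c\<close> ensures that \<open>a\<close> has points to its right, which
  turns the filter into a statement about intervals \<open>{a<..<e}\<close>.\<close>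

lemma decided_at_right:
  fixes M :: "('a::{linordered_ab_group_add,dense_linorder,linorder_topology}, 'f, 'r) expansion"
  assumes "unif_locally_o_minimal_2nd M" "definable1 M X" "a < c"
  shows "\<exists>e>a. {a<..<e} \<subseteq> X \<or> {a<..<e} \<inter> X = {}"
proof -
  have lt: "decided (at_right a) {..<b}" for b
    unfolding decided_def eventually_at_right[OF \<open>a < c\<close>]
    by (metis lessThan_iff \<open>a < c\<close> leI order.strict_trans1 less_le_not_le)
  have gt: "decided (at_right a) {b<..}" for b
    unfolding decided_def eventually_at_right[OF \<open>a < c\<close>]
    by (metis greaterThan_iff \<open>a < c\<close> leI order.strict_trans1 less_le_not_le)
  have "decided (at_right a) X"
    by (rule decided_at_within_locally_o_minimal[OF assms(1,2) lt gt])
  then show ?thesis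
    unfolding decided_def eventually_at_right[OF \<open>a < c\<close>] by fastforce
qed

lemma decided_at_left:
  fixes M :: "('a::{linordered_ab_group_add,dense_linorder,linorder_topology}, 'f, 'r) expansion"
  assumes "unif_locally_o_minimal_2nd M" "definable1 M X" "c < a"
  shows "\<exists>e<a. {e<..<a} \<subseteq> X \<or> {e<..<a} \<inter> X = {}"
proof -
  have lt: "decided (at_left a) {..<b}" for b
    unfolding decided_def eventually_at_left[OF \<open>c < a\<close>]
    by (metis lessThan_iff \<open>c < a\<close> leI order.strict_trans2 less_le_not_le)
  have gt: "decided (at_left a) {b<..}" for b
    unfolding decided_def eventually_at_left[OF \<open>c < a\<close>]
    by (metis greaterThan_iff \<open>c < a\<close> leI order.strict_trans2 less_le_not_le)
  have "decided (at_left a) X"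
    by (rule decided_at_within_locally_o_minimal[OF assms(1,2) lt gt])
  then show ?thesis
    unfolding decided_def eventually_at_left[OF \<open>c < a\<close>] by fastforce
qed

lemma decided_at_bot:
  fixes X :: "'a::linordered_ab_group_add set"
  assumes "finite_union_points_intervals X" "0 < (u::'a)"
  shows "\<exists>b. {..b} \<subseteq> X \<or> {..b} \<inter> X = {}"
proof -
  have lt: "decided at_bot {..<b}" for b :: 'a
  proof -
    \<comment> \<open>The positive element \<open>u\<close> provides points strictly to the left of
      \<open>b\<close>.\<close>
    have "\<forall>x\<le>b - u. x \<in> {..<b}"
      using assms(2) by (auto intro: le_less_trans)
    then show ?thesis unfolding decided_def eventually_at_bot_linorder by blast
  qed
  have gt: "decided at_bot {b<..}" for b :: 'a
  proof -
    have "\<forall>x\<le>b. x \<notin> {b<..}" by auto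
    then show ?thesis unfolding decided_def eventually_at_bot_linorder by blast
  qed
  have "decided at_bot X"
    by (rule decided_finite_union[OF lt gt assms(1)])
  then show ?thesis
    unfolding decided_def eventually_at_bot_linorder by fastforce
qed

section \<open>The boundary of a definable set\<close>

text \<open>In a nontrivial group this is the topological frontier, written with intervals so that
  it is visibly first-order.\<close>

definition bdry :: "'a::linorder set \<Rightarrow> 'a set" where
  "bdry X = {a. \<not> (\<exists>p q. p < a \<and> a < q \<and> ({p<..<q} \<subseteq> X \<or> {p<..<q} \<inter> X = {}))}"

lemma bdry_Compl: "bdry (- X) = bdry X"
proof -
  have "({p<..<q} \<subseteq> - X \<or> {p<..<q} \<inter> - X = {}) \<longleftrightarrow> ({p<..<q} \<subseteq> X \<or> {p<..<q} \<inter> X = {})" for p q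
    by blast
  then show ?thesis by (simp only: bdry_def)
qed

lemma definable1_bdry:
  assumes "definable1 M X"
  shows "definable1 M (bdry X)"
proof -
  have "bdry X = {a. \<not> (\<exists>p q. p < a \<and> a < q \<and>
      ((\<forall>x. p < x \<and> x < q \<longrightarrow> x \<in> X) \<or> (\<forall>x. p < x \<and> x < q \<longrightarrow> \<not> x \<in> X)))}"
    unfolding bdry_def subset_eq disjoint_iff Ball_def greaterThanLessThan_iff by (rule refl)
  then show ?thesis
    unfolding definable1_iff
    by (simp only: mem_Collect_eq) (intro definable_intros definable1_in[OF assms], simp_all)
qed

text \<open>On a short interval on either side of \<open>a\<close> the set is full or empty, so
  neither contains a boundary point. As \<open>a\<close> is arbitrary, the boundary is both closed
  and discrete.\<close>

lemma bdry_isolated: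
  fixes M :: "('a::{linordered_ab_group_add,dense_linorder,linorder_topology}, 'f, 'r) expansion"
  assumes "unif_locally_o_minimal_2nd M" "definable1 M X" "0 < (u::'a)"
  shows "\<exists>e>0. \<forall>d\<in>bdry X. a - e < d \<and> d < a + e \<longrightarrow> d = a"
proof -
  have "a < a + u" "a - u < a" using assms(3) by simp_all
  obtain r where r: "a < r" "{a<..<r} \<subseteq> X \<or> {a<..<r} \<inter> X = {}"
    using decided_at_right[OF assms(1,2) \<open>a < a + u\<close>] by blast
  obtain l where l: "l < a" "{l<..<a} \<subseteq> X \<or> {l<..<a} \<inter> X = {}"
    using decided_at_left[OF assms(1,2) \<open>a - u < a\<close>] by blast
  have "d \<notin> bdry X" if "a < d \<and> d < r \<or> l < d \<and> d < a" for d
    unfolding bdry_def using that l r by blast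
  moreover have "a < d \<and> d < r \<or> l < d \<and> d < a"
    if "a - min (r - a) (a - l) < d" "d < a + min (r - a) (a - l)" "d \<noteq> a" for d
  proof (cases "a < d")
    case True
    have "d < a + (r - a)" using that(2) by (rule less_le_trans) (intro add_left_mono min.cobounded1)
    with True show ?thesis by simp
  next
    case False
    have "a - (a - l) < d" by (rule le_less_trans[OF _ that(1)]) (intro diff_left_mono min.cobounded2)
    with False that(3) show ?thesis by simp
  qed
  ultimately show ?thesis
    using l(1) r(1) by (intro exI[of _ "min (r - a) (a - l)"]) auto
qed

text \<open>Definable connectedness: every point of \<open>{p..q}\<close> has a neighbourhood that
  is contained in \<open>X\<close> or disjoint from it, so membership propagates from
  \<open>p\<close> to \<open>q\<close> by definable induction.\<close>

lemma bdry_free_interval: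
  fixes M :: "('a::{linordered_ab_group_add,dense_linorder}, 'f, 'r) expansion"
  assumes "definably_complete M" "definable1 M X" "p \<le> q" "{p..q} \<inter> bdry X = {}" "p \<in> X"
  shows "q \<in> X"
proof (rule definable_induction[OF assms(1) _ assms(3), of "\<lambda>z. z \<in> X"])
  show "definable_pred M 1 (\<lambda>v. v 0 \<in> X)"
    using assms(2) by (simp add: definable1_iff)
  fix s
  assume "p \<le> s" "s \<le> q"
  then have "s \<notin> bdry X" using assms(4) by auto
  then obtain l r where lr: "l < s" "s < r" "{l<..<r} \<subseteq> X \<or> {l<..<r} \<inter> X = {}"
    unfolding bdry_def by blast
  have *: "l < z \<and> z' < r" if "s < z + min (r - s) (s - l)" "z' < s + min (r - s) (s - l)" for z z'
  proof
    have "z' < s + (r - s)" using that(2) by (rule less_le_trans) (intro add_left_mono min.cobounded1)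
    then show "z' < r" by simp
    have "s < z + (s - l)" using that(1) by (rule less_le_trans) (intro add_left_mono min.cobounded2)
    then have "s + l < z + (s - l) + l" by (rule add_strict_right_mono)
    then show "l < z" by (simp add: add.commute)
  qed
  show "\<exists>e>0. \<forall>z z'. p \<le> z \<and> z \<le> s \<and> s < z + e \<and> s \<le> z' \<and> z' < s + e \<and> z' \<le> q \<and> z \<in> X \<longrightarrow> z' \<in> X"
  proof (intro exI[of _ "min (r - s) (s - l)"] conjI allI impI)
    fix z z'
    assume h: "p \<le> z \<and> z \<le> s \<and> s < z + min (r - s) (s - l) \<and> s \<le> z' \<and>
      z' < s + min (r - s) (s - l) \<and> z' \<le> q \<and> z \<in> X"
    then have "l < z" "z' < r" using * by blast+
    moreover have "z < r" "l < z'" using h lr(1,2) by auto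
    ultimately show "z' \<in> X" using lr(3) h by (auto simp: subset_eq disjoint_iff)
  qed (use lr in simp)
qed fact

lemma finite_bdry_imp_finite_union:
  fixes M :: "('a::{linordered_ab_group_add,dense_linorder}, 'f, 'r) expansion"
  assumes dc: "definably_complete M" and X: "definable1 M X" and fin: "finite (bdry X)"
  shows "finite_union_points_intervals X"
proof -
  let ?D = "bdry X"
  \<comment> \<open>A finite stock of intervals that contains every component of the complement of
    the boundary.\<close>
  define \<J> where "\<J> = (\<lambda>(a, b). {a<..<b}) ` (?D \<times> ?D) \<union> greaterThan ` ?D \<union> lessThan ` ?D \<union> {UNIV}"
  have conn: "y \<in> X" if "x \<in> X" "\<And>z. min x y \<le> z \<Longrightarrow> z \<le> max x y \<Longrightarrow> z \<notin> ?D"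
    for x y
  proof (cases "x \<le> y")
    case True
    then have "{x..y} \<inter> ?D = {}" using that(2) by auto
    with bdry_free_interval[OF dc X True] that(1) show ?thesis by blast
  next
    case False
    then have yx: "y \<le> x" by simp
    then have "{y..x} \<inter> bdry (- X) = {}" using that(2) by (auto simp: bdry_Compl)
    with bdry_free_interval[OF dc definable1_Compl[OF X] yx] that(1) show ?thesis by blast
  qed
  have "\<exists>J\<in>\<J>. x \<in> J \<and> J \<subseteq> X" if x: "x \<in> X" "x \<notin> ?D" for x
  proof -
    let ?L = "{d \<in> ?D. d < x}" and ?R = "{d \<in> ?D. x < d}"
    have f: "finite ?L" "finite ?R" using fin by auto
    \<comment> \<open>The component of \<open>x\<close> in the complement of the boundary: it is
      bounded by the nearest boundary points on either side, where these exist.\<close>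
    define J where "J = {y. (\<forall>d\<in>?L. d < y) \<and> (\<forall>d\<in>?R. y < d)}"
    have "y \<in> X" if "y \<in> J" for y
    proof (rule conn[OF x(1)])
      fix z assume z: "min x y \<le> z" "z \<le> max x y"
      show "z \<notin> ?D"
      proof
        assume "z \<in> ?D"
        with x(2) have "z \<noteq> x" by blast
        with \<open>z \<in> ?D\<close> have "z \<in> ?L \<or> z \<in> ?R" by (simp add: neq_iff)
        then show False using z that by (auto simp: J_def min_def max_def split: if_splits)
      qed
    qed
    then have "J \<subseteq> X" by blast
    moreover have "x \<in> J" by (auto simp: J_def)
    moreover have "J \<in> \<J>"
    proof -
      have L: "(\<forall>d\<in>?L. d < y) \<longleftrightarrow> Max ?L < y" if "?L \<noteq> {}" for y using f that by simp
      have R: "(\<forall>d\<in>?R. y < d) \<longleftrightarrow> y < Min ?R" if "?R \<noteq> {}" for y using f that by simp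
      have maxL: "Max ?L \<in> ?D" if "?L \<noteq> {}" using Max_in[OF f(1) that] by blast
      have minR: "Min ?R \<in> ?D" if "?R \<noteq> {}" using Min_in[OF f(2) that] by blast
      consider "?L = {}" "?R = {}" | "?L = {}" "?R \<noteq> {}" | "?L \<noteq> {}" "?R = {}" | "?L \<noteq> {}" "?R \<noteq> {}"
        by blast
      then show ?thesis
      proof cases
        case 1
        then have "J = UNIV" by (auto simp: J_def)
        then show ?thesis by (simp add: \<J>_def)
      next
        case 2
        then have "J = {..<Min ?R}" unfolding J_def R[OF 2(2)] 2(1) by auto
        then show ?thesis using minR[OF 2(2)] unfolding \<J>_def by blast
      next
        case 3
        then have "J = {Max ?L<..}" unfolding J_def L[OF 3(1)] 3(2) by auto
        then show ?thesis using maxL[OF 3(1)] unfolding \<J>_def by blast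
      next
        case 4
        then have "J = {Max ?L<..<Min ?R}" unfolding J_def L[OF 4(1)] R[OF 4(2)] by auto
        then have "J = (\<lambda>(a, b). {a<..<b}) (Max ?L, Min ?R)" by simp
        then show ?thesis using maxL[OF 4(1)] minR[OF 4(2)] unfolding \<J>_def by blast
      qed
    qed
    ultimately show ?thesis by blast
  qed
  then have "X = (X \<inter> ?D) \<union> \<Union>{J \<in> \<J>. J \<subseteq> X}" by blast
  moreover have "finite (X \<inter> ?D)" "finite {J \<in> \<J>. J \<subseteq> X}"
    using fin by (auto simp: \<J>_def)
  moreover have "\<forall>J\<in>{J \<in> \<J>. J \<subseteq> X}. open_interval J"
    by (auto simp: \<J>_def open_interval_def bounded_open_interval_def unbounded_open_interval_def)
  ultimately show ?thesis
    unfolding finite_union_points_intervals_def by blast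
qed

section \<open>Finiteness of separated and of isolated sets on bounded intervals\<close>

text \<open>A half-open interval of length \<open>e\<close> contains at most one point of
  \<open>D\<close>, and by the archimedean property finitely many of them cover
  \<open>{p..q}\<close>.\<close>

lemma finite_separated:
  fixes M :: "('a::linordered_ab_group_add, 'f, 'r) expansion"
  assumes "archimedean M" "0 < (e::'a)"
    and sep: "\<And>d d'. d \<in> D \<Longrightarrow> d' \<in> D \<Longrightarrow> d < d' \<Longrightarrow> d + e \<le> d'"
    and bounds: "D \<subseteq> {p..q}"
  shows "finite D"
proof -
  have fin: "finite (D \<inter> {..<p + (\<Sum>i<n. e)})" for n :: nat
  proof (induction n)
    case 0
    have "D \<inter> {..<p} = {}" using bounds by fastforce
    then show ?case by simp
  next
    case (Suc n)
    let ?s = "p + (\<Sum>i<n. e)"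
    have "\<exists>x. D \<inter> {?s..<?s + e} \<subseteq> {x}"
    proof (cases "D \<inter> {?s..<?s + e} = {}")
      case False
      then obtain x where x: "x \<in> D" "?s \<le> x" "x < ?s + e" by auto
      have "y = x" if "y \<in> D" "?s \<le> y" "y < ?s + e" for y
      proof (rule ccontr)
        assume "y \<noteq> x"
        then consider "x < y" | "y < x" by (rule linorder_neqE) blast+
        then show False
        proof cases
          case 1
          have "?s + e \<le> x + e" using x(2) by (rule add_right_mono)
          also have "\<dots> \<le> y" using sep[OF x(1) that(1) 1] .
          finally show False using that(3) by simp
        next
          case 2
          have "?s + e \<le> y + e" using that(2) by (rule add_right_mono)
          also have "\<dots> \<le> x" using sep[OF that(1) x(1) 2] .
          finally show False using x(3) by simp
        qed
      qed
      then show ?thesis by (intro exI[of _ x]) auto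
    qed auto
    then have "finite (D \<inter> {?s..<?s + e})"
      by (meson finite.emptyI finite.insertI finite_subset)
    moreover have "D \<inter> {..<p + (\<Sum>i<Suc n. e)} \<subseteq> (D \<inter> {..<?s}) \<union> (D \<inter> {?s..<?s + e})"
      by (auto simp: add.assoc)
    ultimately show ?case using Suc by (meson finite_UnI finite_subset)
  qed
  show ?thesis
  proof (cases "p < q")
    case True
    then have "0 < q - p" by simp
    then obtain n :: nat where "q - p < (\<Sum>i<n. e)"
      using assms(1,2) unfolding archimedean_def by blast
    then have "q < p + (\<Sum>i<n. e)" by (simp add: diff_less_eq add.commute)
    then have "{p..q} \<subseteq> {..<p + (\<Sum>i<n. e)}" by auto
    then have "D \<subseteq> D \<inter> {..<p + (\<Sum>i<n. e)}" using bounds by blast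
    with fin show ?thesis by (meson finite_subset)
  next
    case False
    then have "{p..q} \<subseteq> {p}" by auto
    then have "D \<subseteq> {p}" using bounds by blast
    then show ?thesis by (meson finite.emptyI finite.insertI finite_subset)
  qed
qed

text \<open>Definable induction on the right endpoint turns isolation at each point into a uniform
  gap, and separated sets are finite.\<close>

lemma isolated_finite:
  fixes M :: "('a::{linordered_ab_group_add,dense_linorder}, 'f, 'r) expansion"
  assumes dc: "definably_complete M" and "archimedean M" and D: "definable1 M D" and "0 < (u::'a)"
    and iso: "\<And>a. \<exists>e>0. \<forall>d\<in>D. a - e < d \<and> d < a + e \<longrightarrow> d = a"
  shows "finite (D \<inter> {p..q})"
proof (cases "p \<le> q")
  case True
  define Q where "Q z \<longleftrightarrow> (\<exists>e. 0 < e \<and> (\<forall>d d'. d \<in> D \<and> d' \<in> D \<and> p \<le> d \<and> d < d' \<and> d' \<le> z \<longrightarrow> d + e \<le> d'))" for z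
  have "Q q"
  proof (rule definable_induction[OF dc _ True])
    show "definable_pred M 1 (\<lambda>v. Q (v 0))"
      unfolding Q_def by (intro definable_intros definable1_in[OF D]) simp_all
    show "Q p" unfolding Q_def using \<open>0 < u\<close> by (auto intro!: exI[of _ u])
    fix s
    obtain e where e: "0 < e" "\<And>d. d \<in> D \<Longrightarrow> s - e < d \<Longrightarrow> d < s + e \<Longrightarrow> d = s"
      using iso[of s] by blast
    have "Q z'" if z: "s < z + e" "z' < s + e" and "Q z" for z z'
    proof -
      obtain c where c: "0 < c"
        "\<And>d d'. d \<in> D \<Longrightarrow> d' \<in> D \<Longrightarrow> p \<le> d \<Longrightarrow> d < d' \<Longrightarrow> d' \<le> z \<Longrightarrow> d + c \<le> d'"
        using \<open>Q z\<close> unfolding Q_def by blast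
      \<comment> \<open>Points up to \<open>z\<close> are at least \<open>c\<close> apart. A point
        of \<open>D\<close> beyond \<open>z\<close> can only be \<open>s\<close>, and every smaller
        point is at least \<open>e\<close> away from it.\<close>
      have "d + min c e \<le> d'" if d: "d \<in> D" "d' \<in> D" "p \<le> d" "d < d'" "d' \<le> z'" for d d'
      proof (cases "d' \<le> z")
        case True
        have "d + min c e \<le> d + c" by simp
        also have "\<dots> \<le> d'" using c(2) d True by blast
        finally show ?thesis .
      next
        case False
        have "s - e < z" using z(1) by (simp add: diff_less_eq)
        then have "d' = s" using e(2)[OF d(2)] d(5) z(2) False by simp
        have "d \<le> s - e"
        proof (rule ccontr)
          assume "\<not> d \<le> s - e"
          then have "d = s" using e(2)[OF d(1)] d(4) \<open>d' = s\<close> e(1) by (simp add: add_strict_increasing2 less_le_trans)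
          with d(4) \<open>d' = s\<close> show False by simp
        qed
        then have "d + e \<le> d'" by (simp add: le_diff_eq \<open>d' = s\<close>)
        moreover have "d + min c e \<le> d + e" by simp
        ultimately show ?thesis by (rule order_trans[rotated])
      qed
      then show ?thesis unfolding Q_def using c(1) e(1) by (intro exI[of _ "min c e"]) auto
    qed
    then show "\<exists>e>0. \<forall>z z'. p \<le> z \<and> z \<le> s \<and> s < z + e \<and> s \<le> z' \<and> z' < s + e \<and> z' \<le> q \<and> Q z \<longrightarrow> Q z'"
      using e(1) by blast
  qed
  then obtain e where "0 < e" and "\<And>d d'. d \<in> D \<Longrightarrow> d' \<in> D \<Longrightarrow> p \<le> d \<Longrightarrow> d < d' \<Longrightarrow> d' \<le> q \<Longrightarrow> d + e \<le> d'"
    unfolding Q_def by blast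
  then show ?thesis
    by (intro finite_separated[OF assms(2), of e "D \<inter> {p..q}" p q]) auto
qed simp

section \<open>Extending a function from two parallel lines\<close>

text \<open>
  The function that is \<open>0\<close> on the line \<open>t = 0\<close> and \<open>x\<close> on the line \<open>t = u\<close> is continuous and
  definable on a closed set; \<open>G\<close> is its Tietze extension.
\<close>

lemma Tietze_strip:
  fixes M :: "('a::{linordered_ab_group_add,dense_linorder,linorder_topology}, 'f, 'r) expansion"
  assumes "definable_Tietze M" "0 < (u::'a)"
  obtains G where "definable_pred M 3 (\<lambda>v. v 2 = G (v 0) (v 1))"
    "\<And>x. continuous_on UNIV (G x)" "\<And>x. G x 0 = 0" "\<And>x. G x u = x"
proof -
  let ?A = "{z \<in> pow 2. z 1 = 0 \<or> z 1 = u}"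
  let ?f = "\<lambda>z :: nat \<Rightarrow> 'a. if z 1 = 0 then 0 else z 0"
  have top: "topspace (pow_topology 2) = (pow 2 :: (nat \<Rightarrow> 'a) set)"
    by (simp add: pow_topology_def pow_def)
  have proj: "continuous_map (pow_topology 2) euclidean (\<lambda>z :: nat \<Rightarrow> 'a. z i)" if "i < 2" for i
    unfolding pow_topology_def by (rule continuous_map_product_projection) (use that in simp)
  have "definable M 2 ?A"
    by (intro definable_of_pred definable_intros) simp_all
  moreover have "closedin (pow_topology 2) ?A"
  proof -
    have "closedin (pow_topology 2) {z \<in> topspace (pow_topology 2). z 1 \<in> {0, u}}"
      by (rule closedin_continuous_map_preimage[OF proj]) (simp_all add: closedin_Int)
    then show ?thesis by (simp add: top)
  qed
  moreover have "definable_fun M 2 ?A ?f"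
  proof -
    have "{y(2 := ?f y) |y. y \<in> ?A} =
        {z \<in> pow 3. (z 1 = 0 \<or> z 1 = u) \<and> (z 1 = 0 \<and> z 2 = 0 \<or> \<not> z 1 = 0 \<and> z 2 = z 0)}" (is "?L = ?R")
    proof
      show "?L \<subseteq> ?R"
        using assms(2) by (auto simp: pow_def PiE_def extensional_def)
      show "?R \<subseteq> ?L"
      proof
        fix z assume z: "z \<in> ?R"
        \<comment> \<open>Dropping the last coordinate means resetting it to the default value of
          extensional functions.\<close>
        define y where "y = z(2 := undefined)"
        have "y \<in> ?A" "z = y(2 := ?f y)"
          using z by (auto simp: y_def pow_def PiE_def extensional_def fun_eq_iff)
        then show "z \<in> ?L" by blast
      qed
    qed
    moreover have "definable M 3 ?R"
      by (intro definable_of_pred definable_intros) simp_all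
    ultimately show ?thesis by (simp add: definable_fun_def numeral_3_eq_3 numeral_2_eq_2)
  qed
  moreover have "continuous_map (subtopology (pow_topology 2) ?A) euclidean ?f"
  \<comment> \<open>The two lines are closed and cover the domain; on one the function is constant,
    on the other a projection. The index is the value of the coordinate \<open>z 1\<close>.\<close>
  proof (rule pasting_lemma_closed)
    let ?X = "subtopology (pow_topology 2) ?A"
    have projA: "continuous_map ?X euclidean (\<lambda>z. z i)" if "i < 2" for i
      by (rule continuous_map_from_subtopology[OF proj[OF that]])
    show "finite {0, u}" by simp
    show "closedin ?X {z \<in> topspace ?X. z 1 \<in> {i}}" for i
      by (rule closedin_continuous_map_preimage[OF projA]) simp_all
    show "continuous_map (subtopology ?X {z \<in> topspace ?X. z 1 \<in> {i}}) euclidean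
        (if i = 0 then (\<lambda>_. 0) else (\<lambda>z. z 0))" for i
    proof (cases "i = 0")
      case False
      have "continuous_map (subtopology ?X {z \<in> topspace ?X. z 1 \<in> {i}}) euclidean (\<lambda>z. z 0)"
        by (rule continuous_map_from_subtopology[OF projA]) simp
      with False show ?thesis by (simp only: if_False)
    qed simp
    show "\<exists>j. j \<in> {0, u} \<and> z \<in> {z \<in> topspace ?X. z 1 \<in> {j}} \<and>
        ?f z = (if j = 0 then (\<lambda>_. 0) else (\<lambda>z. z 0)) z" if "z \<in> topspace ?X" for z
      using that by (intro exI[of _ "z 1"]) auto
  qed auto
  ultimately obtain F where F: "definable_fun M 2 (pow 2) F"
    "continuous_map (pow_topology 2) euclidean F" "\<forall>x\<in>?A. F x = ?f x"
    using assms(1)[unfolded definable_Tietze_def, rule_format, of 2 ?A ?f] by auto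
  \<comment> \<open>The point \<open>(x, t)\<close> of the plane as an extensional function.\<close>
  define w where "w x t = (\<lambda>i::nat. if i = 0 then x else if i = 1 then t else undefined)" for x t :: 'a
  have w: "w x t \<in> pow 2" for x t
    by (auto simp: w_def pow_def PiE_def extensional_def)
  define G where "G x t = F (w x t)" for x t
  show thesis
  proof (rule that)
    have "definable M 3 {y(2 := F y) |y. y \<in> pow 2}"
      using F(1) by (simp add: definable_fun_def numeral_3_eq_3 numeral_2_eq_2)
    note definable_pred_of[OF this]
    moreover have "restrict v {..<3} \<in> {y(2 := F y) |y. y \<in> pow 2} \<longleftrightarrow> v 2 = G (v 0) (v 1)" for v
    proof
      assume "restrict v {..<3} \<in> {y(2 := F y) |y. y \<in> pow 2}"
      then obtain y where y: "y \<in> pow 2" "restrict v {..<3} = y(2 := F y)" by blast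
      have v: "v i = (y(2 := F y)) i" if "i < 3" for i
        using fun_cong[OF y(2), of i] that by simp
      have "y = w (v 0) (v 1)"
      proof
        fix i :: nat
        consider "i = 0" | "i = 1" | "i \<ge> 2" by linarith
        then show "y i = w (v 0) (v 1) i"
          using v[of 0] v[of 1] y(1) by cases (auto simp: w_def pow_def PiE_def extensional_def)
      qed
      then show "v 2 = G (v 0) (v 1)" using v[of 2] by (simp add: G_def)
    next
      assume v: "v 2 = G (v 0) (v 1)"
      have "restrict v {..<3} = (w (v 0) (v 1))(2 := F (w (v 0) (v 1)))"
      proof
        fix i :: nat
        consider "i = 0" | "i = 1" | "i = 2" | "i \<ge> 3" by linarith
        then show "restrict v {..<3} i = ((w (v 0) (v 1))(2 := F (w (v 0) (v 1)))) i"
          using v by cases (auto simp: w_def G_def)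
      qed
      then show "restrict v {..<3} \<in> {y(2 := F y) |y. y \<in> pow 2}" using w by blast
    qed
    ultimately show "definable_pred M 3 (\<lambda>v. v 2 = G (v 0) (v 1))" by simp
    show "continuous_on UNIV (G x)" for x
    proof -
      have "continuous_map euclidean (pow_topology 2) (w x)"
        unfolding pow_topology_def continuous_map_componentwise
        by (auto simp: w_def image_subset_iff PiE_def extensional_def)
      from continuous_map_compose[OF this F(2)] show ?thesis
        by (simp add: G_def comp_def[abs_def])
    qed
    show "G x 0 = 0" for x
      using F(3) w[of x 0] by (simp add: G_def w_def)
    show "G x u = x" for x
      using F(3)[rule_format, of "w x u"] w[of x u] assms(2) by (auto simp: G_def w_def)
  qed
qed

section \<open>Moduli of continuity\<close>

text \<open>On \<open>{0..z}\<close>, points at distance less than \<open>c\<close> have values at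
  distance at most \<open>u\<close>. Absolute values are avoided by the symmetry in \<open>t\<close>
  and \<open>t'\<close>.\<close>

definition osc_le :: "('a::linordered_ab_group_add \<Rightarrow> 'a) \<Rightarrow> 'a \<Rightarrow> 'a \<Rightarrow> 'a \<Rightarrow> bool" where
  "osc_le g u z c \<longleftrightarrow>
     (\<forall>t t'. 0 \<le> t \<and> t \<le> z \<and> 0 \<le> t' \<and> t' \<le> z \<and> t < t' + c \<and> t' < t + c \<longrightarrow> g t \<le> g t' + u)"

lemma osc_le_antimono: "osc_le g u z c \<Longrightarrow> c' \<le> c \<Longrightarrow> osc_le g u z c'"
  unfolding osc_le_def by (meson add_left_mono less_le_trans)

lemma definable_pred_osc_le:
  assumes G: "definable_pred M 3 (\<lambda>v. v 2 = G (v 0) (v 1))"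
    and t: "definable_term M n x" "definable_term M n z" "definable_term M n c"
  shows "definable_pred M n (\<lambda>v. osc_le (G (x v)) u (z v) (c v))"
proof -
  \<comment> \<open>\<open>G\<close> is given by its graph and not by a term, so its values enter as
    quantified variables \<open>y\<close> and \<open>y'\<close>.\<close>
  have "definable_pred M 3 (\<lambda>v. \<forall>t t'. 0 \<le> t \<and> t \<le> v 1 \<and> 0 \<le> t' \<and> t' \<le> v 1 \<and> t < t' + v 2 \<and> t' < t + v 2 \<longrightarrow>
      (\<exists>y y'. y = G (v 0) t \<and> y' = G (v 0) t' \<and> y \<le> y' + u))"
    by (intro definable_pred_all definable_pred_imp definable_pred_ex definable_pred_conj
        definable_pred_less definable_pred_le definable_term_var definable_term_const definable_term_add
        definable_pred_subst3[of M "\<lambda>x t y. y = G x t", OF G]) simp_all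
  then have "definable_pred M 3 (\<lambda>v. osc_le (G (v 0)) u (v 1) (v 2))"
    by (simp add: osc_le_def)
  from definable_pred_subst3[OF this t] show ?thesis .
qed

text \<open>Density replaces division by two: of the parts \<open>w\<close> and \<open>u - w\<close>
  the smaller one serves.\<close>

lemma ex_half:
  assumes "0 < (u::'a::{linordered_ab_group_add,dense_linorder})"
  shows "\<exists>v>0. v + v \<le> u"
proof -
  obtain w where w: "0 < w" "w < u" using dense[OF assms] by blast
  have "min w (u - w) + min w (u - w) \<le> w + (u - w)"
    by (rule add_mono) simp_all
  then show ?thesis using w by (intro exI[of _ "min w (u - w)"]) simp
qed

text \<open>Heine's theorem on uniform continuity for the single tolerance \<open>u\<close>, with
  definable induction on the right endpoint in place of compactness.\<close>

lemma ex_osc_le: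
  fixes M :: "('a::{linordered_ab_group_add,dense_linorder,linorder_topology}, 'f, 'r) expansion"
  assumes dc: "definably_complete M"
    and Q: "definable_pred M 1 (\<lambda>v. \<exists>c. 0 < c \<and> osc_le g u (v 0) c)"
    and g: "continuous_on UNIV g" and u: "0 < u" and "0 \<le> (q::'a)"
  shows "\<exists>c. 0 < c \<and> osc_le g u q c"
proof (rule definable_induction[OF dc Q \<open>0 \<le> q\<close>])
  show "\<exists>c. 0 < c \<and> osc_le g u 0 c"
    using u by (intro exI[of _ u]) (auto simp: osc_le_def)
  fix s :: 'a
  obtain v where v: "0 < v" "v + v \<le> u" using ex_half[OF u] by blast
  let ?S = "g -` {g s - v<..<g s + v}"
  have S: "open ?S" "s \<in> ?S"
    using g v(1) by (auto intro: open_vimage)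
  have "s < s + u" "s - u < s" using u by simp_all
  obtain r where r: "s < r" "{s..<r} \<subseteq> ?S"
    using open_right[OF S \<open>s < s + u\<close>] by blast
  obtain l where l: "l < s" "{l<..s} \<subseteq> ?S"
    using open_left[OF S \<open>s - u < s\<close>] by blast
  define e where "e = min (r - s) (s - l)"
  have e: "0 < e" using r(1) l(1) by (simp add: e_def)
  have near: "g s - v < g t \<and> g t < g s + v" if "s - e < t" "t < s + e" for t
  proof -
    have "e \<le> r - s" "e \<le> s - l" by (simp_all add: e_def)
    then have "s + e \<le> r" "l \<le> s - e" by (simp_all add: le_diff_eq add.commute)
    then have "l < t" "t < r" using that by (auto intro: less_le_trans le_less_trans)
    then have "t \<in> {s..<r} \<union> {l<..s}" by auto
    then show ?thesis using r(2) l(2) by auto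
  qed
  show "\<exists>e>0. \<forall>z z'. 0 \<le> z \<and> z \<le> s \<and> s < z + e \<and> s \<le> z' \<and> z' < s + e \<and> z' \<le> q \<and>
    (\<exists>c. 0 < c \<and> osc_le g u z c) \<longrightarrow> (\<exists>c. 0 < c \<and> osc_le g u z' c)"
  proof (rule exI[of _ e], intro conjI allI impI e)
    fix z z'
    assume h: "0 \<le> z \<and> z \<le> s \<and> s < z + e \<and> s \<le> z' \<and> z' < s + e \<and> z' \<le> q \<and>
      (\<exists>c. 0 < c \<and> osc_le g u z c)"
    then obtain c where c: "0 < c" "osc_le g u z c" by blast
    \<comment> \<open>Two points of \<open>{0..z'}\<close> closer than \<open>d\<close> either both
      lie in \<open>{0..z}\<close>, where \<open>c\<close> works, or both lie within
      \<open>e\<close> of \<open>s\<close>, where \<open>g\<close> stays within \<open>v\<close> of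
      \<open>g s\<close>.\<close>
    define d where "d = min c (z - (s - e))"
    have sz: "s - e < z" using h by (simp add: diff_less_eq)
    then have d: "0 < d" "d \<le> c" "d \<le> z - (s - e)" using c(1) by (simp_all add: d_def)
    have close: "s - e < t'" if "z < t" "t < t' + d" for t t'
    proof -
      have "z < t' + d" using that by simp
      also have "\<dots> \<le> t' + (z - (s - e))" using d(3) by simp
      finally show ?thesis by (simp add: algebra_simps)
    qed
    have "g t \<le> g t' + u"
      if t: "0 \<le> t \<and> t \<le> z' \<and> 0 \<le> t' \<and> t' \<le> z' \<and> t < t' + d \<and> t' < t + d" for t t'
    proof (cases "t \<le> z \<and> t' \<le> z")
      case True
      have "t < t' + c" "t' < t + c"
        using t d(2) by (meson add_left_mono less_le_trans)+
      with True t c(2) show ?thesis unfolding osc_le_def by blast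
    next
      case False
      have "s - e < t" "s - e < t'"
        using False close[of t t'] close[of t' t] t sz by (meson less_trans not_le)+
      moreover have "t < s + e" "t' < s + e" using t h by (auto intro: le_less_trans)
      ultimately have "g t < g s + v" "g s - v < g t'" using near by blast+
      then have "g t < g t' + v + v"
        by (metis add_strict_right_mono diff_less_eq less_trans)
      also have "\<dots> \<le> g t' + u" using v(2) by (simp add: add.assoc)
      finally show ?thesis by simp
    qed
    then show "\<exists>c. 0 < c \<and> osc_le g u z' c"
      using d(1) unfolding osc_le_def by blast
  qed
qed

text \<open>Going from \<open>0\<close> to \<open>t\<close> in \<open>n\<close> steps of length at
  most \<open>c'\<close>, the function drops by at most \<open>u\<close> in each step. The step
  length is strictly below \<open>c\<close> because \<open>osc_le\<close> concerns distances
  strictly below \<open>c\<close>.\<close>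

lemma osc_le_lower_bound:
  fixes c :: "'a::linordered_ab_group_add"
  assumes "osc_le g u q c" "g 0 = 0" "0 < c'" "c' < c"
  shows "0 \<le> t \<Longrightarrow> t \<le> q \<Longrightarrow> t \<le> (\<Sum>i<n. c') \<Longrightarrow> 0 \<le> g t + (\<Sum>i<n::nat. u)"
proof (induction n arbitrary: t)
  case 0
  then have "t = 0" by simp
  then show ?case using assms(2) by simp
next
  case (Suc n)
  define t' where "t' = max 0 (t - c')"
  have n0: "0 \<le> (\<Sum>i<n. c')" using assms(3) by (simp add: sum_nonneg)
  have t': "0 \<le> t'" "t' \<le> t" "t' \<le> (\<Sum>i<n. c')" "t - c' \<le> t'"
    using Suc.prems assms(3) n0 by (simp_all add: t'_def diff_le_eq)
  then have IH: "0 \<le> g t' + (\<Sum>i<n. u)"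
    using Suc.prems by (intro Suc.IH) auto
  have "t \<le> t' + c'" using t'(4) by (simp add: diff_le_eq)
  also have "\<dots> < t' + c" using assms(4) by simp
  finally have "t < t' + c" .
  moreover have "t < t + c" using less_trans[OF assms(3,4)] by simp
  with t'(2) have "t' < t + c" by (rule le_less_trans)
  ultimately have "g t' \<le> g t + u"
    using assms(1) t' Suc.prems unfolding osc_le_def by (meson order_trans)
  then have "g t' + (\<Sum>i<n. u) \<le> g t + u + (\<Sum>i<n. u)" by simp
  with IH have "0 \<le> g t + u + (\<Sum>i<n. u)" by (rule order_trans)
  then show ?case by (simp add: add_ac)
qed

text \<open>
  \<open>k x\<close> is the supremum of the moduli \<open>c\<close> such that some \<open>G x'\<close> with \<open>x' \<le> x\<close> varies by at most
  \<open>u\<close> over distances less than \<open>c\<close>. As \<open>G x'\<close> descends from \<open>0\<close> to \<open>x'\<close> on an interval of fixed length and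
  the group is archimedean, \<open>k\<close> tends to \<open>0\<close> at minus infinity.
\<close>

lemma Tietze_modulus:
  fixes M :: "('a::{linordered_ab_group_add,dense_linorder,linorder_topology}, 'f, 'r) expansion"
  assumes dc: "definably_complete M" and arch: "archimedean M" and u: "0 < (u::'a)"
    and G: "definable_pred M 3 (\<lambda>v. v 2 = G (v 0) (v 1))"
    and cont: "\<And>x. continuous_on UNIV (G x)" and G0: "\<And>x. G x 0 = 0" and Gu: "\<And>x. G x u = x"
  obtains k b where "definable_pred M 2 (\<lambda>v. v 0 < b \<and> v 1 = k (v 0))"
    "\<And>x. x < b \<Longrightarrow> 0 < k x" "\<And>x y. x \<le> y \<Longrightarrow> y < b \<Longrightarrow> k x \<le> k y"
    "\<And>c. 0 < c \<Longrightarrow> \<exists>a. \<forall>x<a. x < b \<longrightarrow> k x \<le> c"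
proof -
  \<comment> \<open>Admitting all \<open>x' \<le> x\<close> makes \<open>R\<close> monotone in
    \<open>x\<close>, and hence \<open>k\<close> nondecreasing.\<close>
  define R where "R x c \<longleftrightarrow> 0 < c \<and> (\<exists>x'. x' \<le> x \<and> osc_le (G x') u u c)" for x c
  have R: "definable_pred M 2 (\<lambda>v. R (v 0) (v 1))"
    unfolding R_def by (intro definable_intros definable_pred_osc_le[OF G]) simp_all
  have R_mono: "R x c \<Longrightarrow> x \<le> y \<Longrightarrow> R y c" for x y c
    unfolding R_def by (meson order_trans)
  have R_anti: "R x c \<Longrightarrow> 0 < c' \<Longrightarrow> c' \<le> c \<Longrightarrow> R x c'" for x c c'
    unfolding R_def using osc_le_antimono by blast
  have R_ex: "\<exists>c. R x c" for x
  proof -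
    have "definable_pred M 1 (\<lambda>v. \<exists>c. 0 < c \<and> osc_le (G x) u (v 0) c)"
      by (intro definable_intros definable_pred_osc_le[OF G]) simp_all
    from ex_osc_le[OF dc this cont u less_imp_le[OF u]]
    obtain c where "0 < c" "osc_le (G x) u u c" by (elim exE conjE)
    then have "R x c" unfolding R_def by (intro conjI exI[of _ x] order_refl)
    then show ?thesis ..
  qed
  \<comment> \<open>A modulus above \<open>u\<close> would compare the endpoints \<open>0\<close>
    and \<open>u\<close> directly and give \<open>- u \<le> x'\<close>. So below \<open>- u\<close>
    the moduli are bounded, which is why \<open>b\<close> is taken to be \<open>- u\<close>.\<close>
  have R_le: "c \<le> u" if Rx: "R x c" "x < - u" for x c
  proof (rule ccontr)
    assume "\<not> c \<le> u"
    obtain x' where x': "x' \<le> x" "osc_le (G x') u u c" using Rx(1) unfolding R_def by blast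
    have "0 < c" "u < c" using \<open>\<not> c \<le> u\<close> Rx(1) by (simp_all add: R_def)
    then have "G x' 0 \<le> G x' u + u"
      using x'(2)[unfolded osc_le_def, rule_format, of 0 u] u by (simp add: add_pos_pos)
    then have "- u \<le> x'" using diff_le_eq[of 0 u x'] by (simp add: G0 Gu)
    with x'(1) Rx(2) show False by simp
  qed
  have "\<exists>s. is_sup {c. R x c} s" if "x < - u" for x
  proof -
    obtain c where "R x c" using R_ex by blast
    have "definable1 M {c. R x c}"
      unfolding definable1_iff mem_Collect_eq
      by (rule definable_pred_subst2[OF R]) (simp_all add: definable_term_const definable_term_var)
    then show ?thesis using ex_is_sup[OF dc, of "{c. R x c}" c u] \<open>R x c\<close> R_le that by blast
  qed
  then obtain k where k: "is_sup {c. R x c} (k x)" if "x < - u" for x by metis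
  show thesis
  proof (rule that[of "- u" k])
    have "(v 0 < - u \<and> v 1 = k (v 0)) \<longleftrightarrow> (v 0 < - u \<and> is_sup {c. R (v 0) c} (v 1))" for v :: "nat \<Rightarrow> 'a"
      using k[of "v 0"] is_sup_unique by auto
    then show "definable_pred M 2 (\<lambda>v. v 0 < - u \<and> v 1 = k (v 0))"
      by (simp only:) (intro definable_intros definable_pred_is_sup[OF R], simp_all)
    show "0 < k x" if "x < - u" for x
    proof -
      obtain c where "R x c" using R_ex by blast
      then have "0 < c" "c \<le> k x" using k[OF that] by (auto simp: R_def is_sup_def)
      then show ?thesis by simp
    qed
    show "k x \<le> k y" if "x \<le> y" "y < - u" for x y
    proof -
      have "x < - u" using that by simp
      then show ?thesis using k[of x] k[OF that(2)] R_mono[OF _ that(1)] by (auto simp: is_sup_def)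
    qed
    fix c :: 'a assume "0 < c"
    then obtain c' where c': "0 < c'" "c' < c" using dense by blast
    then obtain n :: nat where n: "u < (\<Sum>i<n. c')" using arch u unfolding archimedean_def by blast
    \<comment> \<open>With \<open>n\<close> steps of length \<open>c'\<close> exceeding the distance
      from \<open>0\<close> to \<open>u\<close>, a function with modulus \<open>c\<close> cannot
      descend below minus the \<open>n\<close>-fold sum of \<open>u\<close>. As \<open>R x\<close>
      is closed downwards, excluding \<open>c\<close> excludes everything above it.\<close>
    have "k x \<le> c" if x: "x < - (\<Sum>i<n. u)" "x < - u" for x
    proof -
      have "\<not> R x c"
      proof
        assume "R x c"
        then obtain x' where x': "x' \<le> x" "osc_le (G x') u u c" unfolding R_def by blast
        have "0 \<le> G x' u + (\<Sum>i<n. u)"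
          by (rule osc_le_lower_bound[OF x'(2) G0 c']) (use u n in auto)
        then have "- (\<Sum>i<n. u) \<le> x'" using diff_le_eq[of 0 "\<Sum>i<n. u" x'] by (simp add: Gu)
        with x' x show False by simp
      qed
      then have "\<forall>d\<in>{d. R x d}. d \<le> c"
        using R_anti \<open>0 < c\<close> by (metis linear mem_Collect_eq)
      then show ?thesis using k[OF x(2)] unfolding is_sup_def by blast
    qed
    then show "\<exists>a. \<forall>x<a. x < - u \<longrightarrow> k x \<le> c" by blast
  qed
qed

section \<open>O-minimality and the homeomorphism\<close>

text \<open>The limit of \<open>k\<close> in the form in which it is used: along a set
  \<open>E\<close> that is unbounded below.\<close>

lemma modulus_small_on:
  fixes k :: "'a::{linordered_ab_group_add,dense_linorder} \<Rightarrow> 'a"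
  assumes "\<And>c. 0 < c \<Longrightarrow> \<exists>a. \<forall>x<a. x < b \<longrightarrow> k x \<le> c"
    and "\<And>a. \<exists>d\<in>E. d < a" and "0 < e"
  shows "\<exists>d\<in>E. d < b \<and> d < a \<and> k d < e"
proof -
  obtain c where c: "0 < c" "c < e" using dense[OF assms(3)] by blast
  obtain a' where a': "\<forall>x<a'. x < b \<longrightarrow> k x \<le> c" using assms(1)[OF c(1)] by blast
  obtain d where "d \<in> E" "d < min a' (min a b)" using assms(2) by blast
  moreover from this have "k d \<le> c" using a' by simp
  ultimately show ?thesis using c(2) by (intro bexI[of _ d]) auto
qed

text \<open>
  A set of type \<open>\<omega>\<^sup>*\<close> would be sent by \<open>k\<close> to a definable set that accumulates at \<open>0\<close> but has only
  finitely many elements above each of its members.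
\<close>

lemma finite_of_finite_above:
  fixes M :: "('a::{linordered_ab_group_add,dense_linorder,linorder_topology}, 'f, 'r) expansion"
  assumes lom: "unif_locally_o_minimal_2nd M" and u: "0 < (u::'a)"
    and k: "definable_pred M 2 (\<lambda>v. v 0 < b \<and> v 1 = k (v 0))"
    and pos: "\<And>x. x < b \<Longrightarrow> 0 < k x" and mono: "\<And>x y. x \<le> y \<Longrightarrow> y < b \<Longrightarrow> k x \<le> k y"
    and lim: "\<And>c. 0 < c \<Longrightarrow> \<exists>a. \<forall>x<a. x < b \<longrightarrow> k x \<le> c"
    and E: "definable1 M E" and fin: "\<And>p. finite (E \<inter> {p..})"
  shows "finite E"
proof (rule ccontr)
  assume inf: "infinite E"
  have unb: "\<exists>d\<in>E. d < a" for a
  proof (rule ccontr)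
    assume "\<not> ?thesis"
    then have "E = E \<inter> {a..}" by auto
    with fin[of a] inf show False by simp
  qed
  define K where "K = {c. \<exists>d. d \<in> E \<and> d < b \<and> c = k d}"
  have "definable1 M K"
    unfolding definable1_iff K_def mem_Collect_eq
    by (intro definable_intros definable1_in[OF E]
        definable_pred_subst2[of M "\<lambda>x y. x < b \<and> y = k x", OF k]) simp_all
  then obtain e where e: "0 < e" "{0<..<e} \<subseteq> K \<or> {0<..<e} \<inter> K = {}"
    using decided_at_right[OF lom _ u] by blast
  \<comment> \<open>This \<open>d\<close> shows that \<open>K\<close> meets \<open>{0<..<e}\<close>,
    which leaves only the alternative that \<open>K\<close> contains it.\<close>
  obtain d where d: "d \<in> E" "d < b" "k d < e"
    using modulus_small_on[OF lim unb e(1)] by blast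
  then have "k d \<in> {0<..<e} \<inter> K" using pos by (auto simp: K_def)
  then have sub: "{0<..<e} \<subseteq> K" using e(2) by blast
  \<comment> \<open>By monotonicity, values above \<open>k d\<close> come from the finitely many
    points of \<open>E\<close> above \<open>d\<close>, whereas a nonempty interval is
    infinite.\<close>
  have "{k d<..<e} \<subseteq> k ` (E \<inter> {d..})"
  proof
    fix c assume c: "c \<in> {k d<..<e}"
    then have "0 < c" using pos[OF d(2)] by auto
    then have "c \<in> K" using sub c by auto
    then obtain d' where d': "d' \<in> E" "d' < b" "c = k d'" by (auto simp: K_def)
    have "d \<le> d'"
    proof (rule ccontr)
      assume "\<not> d \<le> d'"
      then have "k d' \<le> k d" using mono[of d' d] d(2) by simp
      with c d'(3) show False by auto
    qed
    with d' show "c \<in> k ` (E \<inter> {d..})" by blast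
  qed
  moreover have "infinite {k d<..<e}" using d(3) by (rule infinite_Ioo)
  ultimately show False using fin[of d] by (meson finite_imageI finite_subset)
qed

section \<open>Inverting the modulus\<close>

text \<open>A monotone map with open image is continuous; this applies to \<open>f\<close> and to
  its inverse.\<close>

lemma homeomorphic_map_strict_mono:
  fixes f :: "'a::{linorder_topology,dense_order} \<Rightarrow> 'b::{linorder_topology,dense_order}"
  assumes f: "strict_mono_on A f" and "open A" "open (f ` A)"
  shows "homeomorphic_map (top_of_set A) (top_of_set (f ` A)) f"
proof -
  have inj: "inj_on f A" using f by (rule strict_mono_on_imp_inj_on)
  have le: "f x \<le> f y \<longleftrightarrow> x \<le> y" if "x \<in> A" "y \<in> A" for x y
    using f that by (rule strict_mono_on_less_eq)
  have "continuous_on A f"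
    using assms(3) by (rule continuous_onI_mono) (simp add: le)
  moreover have "continuous_on (f ` A) (inv_into A f)"
  proof (rule continuous_onI_mono)
    show "open (inv_into A f ` f ` A)" using inj assms(2) by (simp add: inv_into_image_cancel)
    show "inv_into A f x \<le> inv_into A f y" if "x \<in> f ` A" "y \<in> f ` A" "x \<le> y" for x y
      using that by (auto simp: inv_into_f_f[OF inj] le)
  qed
  ultimately have "homeomorphic_maps (top_of_set A) (top_of_set (f ` A)) f (inv_into A f)"
    using inj by (auto simp: homeomorphic_maps_def)
  then show ?thesis by (rule homeomorphic_maps_map[THEN iffD1, THEN conjunct1])
qed

text \<open>The map is a generalized inverse of \<open>k\<close>: it sends \<open>c\<close> to the
  supremum of the fibre over \<open>c\<close>. Constancy of \<open>k\<close> on intervals is thereby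
  harmless.\<close>

lemma o_minimal_imp_homeomorphism:
  fixes M :: "('a::{linordered_ab_group_add,dense_linorder,linorder_topology}, 'f, 'r) expansion"
  assumes dc: "definably_complete M" and lom: "unif_locally_o_minimal_2nd M" and omin: "o_minimal M"
    and u: "0 < (u::'a)"
    and k: "definable_pred M 2 (\<lambda>v. v 0 < b \<and> v 1 = k (v 0))"
    and pos: "\<And>x. x < b \<Longrightarrow> 0 < k x" and mono: "\<And>x y. x \<le> y \<Longrightarrow> y < b \<Longrightarrow> k x \<le> k y"
    and lim: "\<And>c. 0 < c \<Longrightarrow> \<exists>a. \<forall>x<a. x < b \<longrightarrow> k x \<le> c"
  shows "\<exists>(c::'a) a f. definable_fun1 M {0<..<c} f \<and> strict_mono_on {0<..<c} f \<and>
    homeomorphic_map (top_of_set {0<..<c}) (top_of_set {..<a}) f"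
proof -
  have unb: "\<exists>d\<in>UNIV. d < a" for a :: 'a
    using u by (intro bexI[of _ "a - u"]) simp_all
  define R where "R c x \<longleftrightarrow> x < b \<and> c = k x" for c x
  have R: "definable_pred M 2 (\<lambda>v. R (v 0) (v 1))"
    unfolding R_def
    by (rule definable_pred_subst2[of M "\<lambda>x y. x < b \<and> y = k x", OF k]) (simp_all add: definable_term_var)
  have "definable1 M {c. \<exists>x. R c x}"
    unfolding definable1_iff mem_Collect_eq
    by (intro definable_intros definable_pred_subst2[OF R]) simp_all
  then obtain e where e: "0 < e" "{0<..<e} \<subseteq> {c. \<exists>x. R c x} \<or> {0<..<e} \<inter> {c. \<exists>x. R c x} = {}"
    using decided_at_right[OF lom _ u] by blast
  obtain d where d: "d < b" "k d < e"
    using modulus_small_on[OF lim unb e(1)] by blast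
  then have "k d \<in> {0<..<e} \<inter> {c. \<exists>x. R c x}" using pos by (auto simp: R_def)
  then have ex: "\<exists>x. R c x" if "0 < c" "c < e" for c using e(2) that by auto
  have "\<exists>s. is_sup {x. R c x} s" if c: "0 < c" "c < e" for c
  proof -
    obtain x where "R c x" using ex[OF c] by blast
    have "definable1 M {x. R c x}"
      unfolding definable1_iff mem_Collect_eq
      by (rule definable_pred_subst2[OF R]) (simp_all add: definable_term_const definable_term_var)
    moreover have "y \<le> b" if "y \<in> {x. R c x}" for y
      using that by (auto simp: R_def)
    ultimately show ?thesis using ex_is_sup[OF dc, of "{x. R c x}" x b] \<open>R c x\<close> by blast
  qed
  then obtain f where f: "\<And>c. 0 < c \<Longrightarrow> c < e \<Longrightarrow> is_sup {x. R c x} (f c)" by metis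
  have R_less: "x < x'" if "R c x" "R c' x'" "c < c'" for c c' x x'
  proof (rule ccontr)
    assume "\<not> x < x'"
    then have "k x' \<le> k x" using mono[of x' x] that(1) by (simp add: R_def)
    with that show False by (simp add: R_def)
  qed
  \<comment> \<open>Fibres over larger values lie further right. Points of the fibres over two
    intermediate values \<open>c1 < c2\<close> keep the suprema strictly apart.\<close>
  have f_mono: "f c < f c'" if c: "0 < c" "c < c'" "c' < e" for c c'
  proof -
    obtain c1 where c1: "c < c1" "c1 < c'" using dense[OF c(2)] by blast
    obtain c2 where c2: "c1 < c2" "c2 < c'" using dense[OF c1(2)] by blast
    have "0 < c1" "c1 < e" "0 < c2" "c2 < e" "0 < c'" "c < e" using c c1 c2 by order+
    then obtain x1 x2 x' where x1: "R c1 x1" and x2: "R c2 x2" and x': "R c' x'"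
      using ex c(3) by meson
    have "\<forall>x\<in>{x. R c x}. x \<le> x1" using R_less[OF _ x1 c1(1)] by (auto intro: less_imp_le)
    moreover have "is_sup {x. R c x} (f c)" using f[OF c(1) \<open>c < e\<close>] .
    ultimately have "f c \<le> x1" by (simp add: is_sup_def)
    also have "x1 < x2" using R_less[OF x1 x2 c2(1)] .
    also have "x2 < x'" using R_less[OF x2 x' c2(2)] .
    also have "x' \<le> f c'" using f[OF \<open>0 < c'\<close> c(3)] x' by (simp add: is_sup_def)
    finally show ?thesis .
  qed
  \<comment> \<open>If \<open>y\<close> is far to the left, all fibres over values below
    \<open>k y\<close> lie to the left of \<open>y\<close>.\<close>
  have f_unb: "\<exists>c. 0 < c \<and> c < e \<and> f c < a" for a
  proof -
    obtain y where y: "y < b" "y < a" "k y < e"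
      using modulus_small_on[OF lim unb e(1), of a] by blast
    obtain c where c: "0 < c" "c < k y" using dense[OF pos[OF y(1)]] by blast
    have "R (k y) y" using y(1) by (simp add: R_def)
    from R_less[OF _ this c(2)] have "\<forall>x\<in>{x. R c x}. x \<le> y" by (auto intro: less_imp_le)
    moreover have "c < e" using c(2) y(3) by simp
    ultimately have "f c \<le> y" using f[OF c(1)] by (simp add: is_sup_def)
    with y(2) c(1) \<open>c < e\<close> show ?thesis by (intro exI[of _ c]) auto
  qed
  \<comment> \<open>The range of \<open>f\<close> on \<open>{0<..<e}\<close>, stated through
    \<open>is_sup\<close> so that it is definable. Being unbounded below, it contains a ray
    \<open>{..a}\<close> by o-minimality.\<close>
  define Y where "Y = {y. \<exists>c. 0 < c \<and> c < e \<and> is_sup {x. R c x} y}"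
  have Y: "y \<in> Y \<longleftrightarrow> (\<exists>c. 0 < c \<and> c < e \<and> y = f c)" for y
    unfolding Y_def using f is_sup_unique by blast
  have "definable1 M Y"
    unfolding definable1_iff Y_def mem_Collect_eq
    by (intro definable_intros definable_pred_is_sup[OF R]) simp_all
  then have "finite_union_points_intervals Y"
    using omin by (simp add: o_minimal_def)
  then obtain a where a: "{..a} \<subseteq> Y \<or> {..a} \<inter> Y = {}"
    using decided_at_bot[OF _ u] by blast
  \<comment> \<open>With \<open>f c0\<close> below \<open>a\<close>, no value to the left of
    \<open>f c0\<close> is missed, so \<open>{0<..<c0}\<close> is mapped onto a ray.\<close>
  obtain c0 where c0: "0 < c0" "c0 < e" "f c0 < a" using f_unb by blast
  then have "f c0 \<in> {..a} \<inter> Y" by (auto simp: Y)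
  then have sub: "{..a} \<subseteq> Y" using a by blast
  have img: "f ` {0<..<c0} = {..<f c0}"
  proof
    show "f ` {0<..<c0} \<subseteq> {..<f c0}" using f_mono c0 by auto
    show "{..<f c0} \<subseteq> f ` {0<..<c0}"
    proof
      fix y assume y: "y \<in> {..<f c0}"
      then have "y \<in> Y" using sub c0(3) by auto
      then obtain c where c: "0 < c" "c < e" "y = f c" by (auto simp: Y)
      have "c < c0"
      proof (rule ccontr)
        assume "\<not> c < c0"
        then have "c = c0 \<or> c0 < c" by auto
        then have "f c0 \<le> f c" using f_mono[of c0 c] c c0 by auto
        with y c(3) show False by simp
      qed
      with c show "y \<in> f ` {0<..<c0}" by auto
    qed
  qed
  have sm: "strict_mono_on {0<..<c0} f"
    using f_mono c0 by (auto intro!: strict_mono_onI)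
  have "(v 0 \<in> {0<..<c0} \<and> v 1 = f (v 0)) \<longleftrightarrow>
      (0 < v 0 \<and> v 0 < c0 \<and> is_sup {x. R (v 0) x} (v 1))" for v :: "nat \<Rightarrow> 'a"
    using f[of "v 0"] less_trans[OF _ c0(2), of "v 0"] by (auto intro: is_sup_unique)
  then have "definable_fun1 M {0<..<c0} f"
    unfolding definable_fun1_iff
    by (simp only:) (intro definable_intros definable_pred_is_sup[OF R], simp_all)
  moreover have "homeomorphic_map (top_of_set {0<..<c0}) (top_of_set {..<f c0}) f"
    using homeomorphic_map_strict_mono[OF sm] by (simp add: img)
  ultimately show ?thesis using sm by blast
qed

theorem theorem5p5:
  fixes M :: "('a::{linordered_ab_group_add,dense_linorder,linorder_topology}, 'f, 'r) expansion"
  assumes "DCULOAS M" and "archimedean M" and "definable_Tietze M"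
  shows "o_minimal M \<and>
    (\<exists>I J f. bounded_open_interval I \<and> unbounded_open_interval J \<and>
       definable_fun1 M I f \<and>
       (strict_mono_on I f \<or> strict_antimono_on I f) \<and>
       homeomorphic_map (subtopology euclidean I) (subtopology euclidean J) f)"
proof (cases "\<exists>u::'a. 0 < u")
  \<comment> \<open>In the trivial group every set is finite, and the empty set is both a bounded
    interval and an unbounded one, \<open>{0<..}\<close>.\<close>
  case False
  then have zero: "x = 0" for x :: 'a
    by (metis neg_0_less_iff_less linorder_neqE)
  have "finite X" for X :: "'a set"
    by (rule finite_subset[of _ "{0}"]) (use zero in auto)
  then have "o_minimal M"
    unfolding o_minimal_def finite_union_points_intervals_def
    by (intro allI impI exI[of _ "{}::'a set set"]) auto
  moreover have "{0::'a<..} = {}" using False by auto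
  then have "bounded_open_interval ({}::'a set)" "unbounded_open_interval ({}::'a set)"
    unfolding bounded_open_interval_def unbounded_open_interval_def
    by (metis greaterThanLessThan_empty order_refl, metis)
  moreover have "definable_pred M 2 (\<lambda>v. v 0 < v 0)"
    by (intro definable_intros) simp_all
  then have "definable_fun1 M {} id" by (simp add: definable_fun1_iff)
  moreover have "strict_mono_on ({}::'a set) id" by (rule strict_mono_onI) simp
  ultimately show ?thesis
    using homeomorphic_map_id[of "top_of_set ({}::'a set)"] by blast
next
  case True
  then obtain u :: 'a where u: "0 < u" ..
  have dc: "definably_complete M" and lom: "unif_locally_o_minimal_2nd M"
    using assms(1) by (auto simp: DCULOAS_def)
  obtain G where G: "definable_pred M 3 (\<lambda>v. v 2 = G (v 0) (v 1))"
    "\<And>x. continuous_on UNIV (G x)" "\<And>x. G x 0 = 0" "\<And>x. G x u = x"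
    using Tietze_strip[OF assms(3) u] by blast
  obtain k b where k: "definable_pred M 2 (\<lambda>v. v 0 < b \<and> v 1 = k (v 0))"
    "\<And>x. x < b \<Longrightarrow> 0 < k x" "\<And>x y. x \<le> y \<Longrightarrow> y < b \<Longrightarrow> k x \<le> k y"
    "\<And>c. 0 < c \<Longrightarrow> \<exists>a. \<forall>x<a. x < b \<longrightarrow> k x \<le> c"
    by (rule Tietze_modulus[OF dc assms(2) u G]) (rule that; assumption)
  note finite_above = finite_of_finite_above[OF lom u k]
  have omin: "o_minimal M"
    unfolding o_minimal_def
  proof (intro allI impI)
    fix X assume X: "definable1 M X"
    let ?D = "bdry X"
    note D = definable1_bdry[OF X]
    have fin: "finite (?D \<inter> {p..q})" for p q
      by (rule isolated_finite[OF dc assms(2) D u bdry_isolated[OF lom X u]])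
    \<comment> \<open>The part of the boundary up to \<open>0\<close> has only finitely many points
      above each \<open>p\<close>; the part from \<open>0\<close> on is treated afterwards by
      reflection at \<open>0\<close>.\<close>
    have "finite {x. x \<le> 0 \<and> x \<in> ?D}"
    proof (rule finite_above)
      show "definable1 M {x. x \<le> 0 \<and> x \<in> ?D}"
        unfolding definable1_iff mem_Collect_eq by (intro definable_intros definable1_in[OF D]) simp_all
      show "finite ({x. x \<le> 0 \<and> x \<in> ?D} \<inter> {p..})" for p
        by (rule finite_subset[OF _ fin[of p 0]]) auto
    qed
    moreover have "finite {x. x \<le> 0 \<and> (\<exists>d. d \<in> ?D \<and> x + d = 0)}"
    proof (rule finite_above)
      show "definable1 M {x. x \<le> 0 \<and> (\<exists>d. d \<in> ?D \<and> x + d = 0)}"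
        unfolding definable1_iff mem_Collect_eq by (intro definable_intros definable1_in[OF D]) simp_all
      show "finite ({x. x \<le> 0 \<and> (\<exists>d. d \<in> ?D \<and> x + d = 0)} \<inter> {p..})" for p
        by (rule finite_subset[OF _ finite_imageI[OF fin[of 0 "- p"], of uminus]])
          (force simp: add_eq_0_iff)
    qed
    ultimately have "finite ({x. x \<le> 0 \<and> x \<in> ?D} \<union> uminus ` {x. x \<le> 0 \<and> (\<exists>d. d \<in> ?D \<and> x + d = 0)})"
      by simp
    moreover have "?D \<subseteq> {x. x \<le> 0 \<and> x \<in> ?D} \<union> uminus ` {x. x \<le> 0 \<and> (\<exists>d. d \<in> ?D \<and> x + d = 0)}"
    proof
      fix d assume d: "d \<in> ?D"
      show "d \<in> {x. x \<le> 0 \<and> x \<in> ?D} \<union> uminus ` {x. x \<le> 0 \<and> (\<exists>d. d \<in> ?D \<and> x + d = 0)}"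
      proof (cases "d \<le> 0")
        case False
        then have "- d \<in> {x. x \<le> 0 \<and> (\<exists>d. d \<in> ?D \<and> x + d = 0)}" using d by force
        then have "- (- d) \<in> uminus ` {x. x \<le> 0 \<and> (\<exists>d. d \<in> ?D \<and> x + d = 0)}" by (rule imageI)
        then show ?thesis by simp
      qed (use d in simp)
    qed
    ultimately have "finite ?D" by (rule finite_subset[rotated])
    then show "finite_union_points_intervals X"
      by (rule finite_bdry_imp_finite_union[OF dc X])
  qed
  moreover have "\<exists>(c::'a) a f. definable_fun1 M {0<..<c} f \<and> strict_mono_on {0<..<c} f \<and>
      homeomorphic_map (top_of_set {0<..<c}) (top_of_set {..<a}) f"
    by (rule o_minimal_imp_homeomorphism[OF dc lom omin u k])
  then obtain c a f where "definable_fun1 M {0<..<c} f" "strict_mono_on {0<..<c} f"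
    "homeomorphic_map (top_of_set {0<..<c}) (top_of_set {..<a::'a}) f"
    by (elim exE conjE)
  moreover have "bounded_open_interval {0<..<c}" "unbounded_open_interval {..<a}"
    by (auto simp: bounded_open_interval_def unbounded_open_interval_def)
  ultimately show ?thesis by blast
qed

end
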